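(* Suppose that $V(r,z)=\|z-r\|^2/2$ for any $r,z\in Z$, where $\|\cdot\|$ is the norm induced by the inner product (so that $\mu=1$), let $u^*$ be a strong solution of $VI(Z;G,H,J)$, and let $D:=\|r_1-u^*\|$. Suppose the bounded variance assumption A1 holds and the parameters $\{\alpha_t\}_{t\ge1}$ and $\{\gamma_t\}_{t\ge1}$ (with $\gamma_t>0$) in the stochastic AMP method are chosen such that $\alpha_1=1$, $0\le\alpha_t<1$ for all $t>1$, and, for some $c,q\in(0,1)$ and all $t\ge1$, $$L_G\alpha_t\gamma_t+3L_H^2\gamma_t^2\le c^2<q\qquad\text{and}\qquad\frac{\alpha_t}{\Gamma_t\gamma_t}=\frac{\alpha_{t+1}}{\Gamma_{t+1}\gamma_{t+1}},$$ where $\Gamma_1=1$ and $\Gamma_t=(1-\alpha_t)\Gamma_{t-1}$ for $t>1$. Then for all $t\ge1$ there exist a (random) perturbation vector $v_{t+1}\in\mathcal E$ and a (random) residual $\varepsilon_{t+1}\ge0$ such that $\tilde g(w^{ag}_{t+1},v_{t+1})\le\varepsilon_{t+1}$. Moreover, for all $t\ge1$, $$\mathbb E[\|v_{t+1}\|]\le\frac{\alpha_t}{\gamma_t}\left(2D+2\sqrt{D^2+C_t^2}\right),$$ $$\mathbb E[\varepsilon_{t+1}]\le\frac{\alpha_t}{\gamma_t}\left[(3+6\theta)D^2+(1+6\theta)C_t^2\right]+\frac{18\alpha_t^2\sigma_H^2}{\gamma_t^2}\sum_{i=1}^t\gamma_i^3,$$ where $$\theta=\max\left\{1,\frac{c^2}{q-c^2}\right\}\quad\text{and}\quad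 C_t=\sqrt{\left[4\sigma_H^2+\left(1+\frac1{2(1-q)}\right)\sigma_G^2\right]\sum_{i=1}^t\gamma_i^2}.$$
   Context: Setting. $\mathcal E$ is a finite-dimensional real vector space with inner product $\langle\cdot,\cdot\rangle$ and induced norm $\|\cdot\|$; $Z\subset\mathcal E$ is a nonempty closed convex set (possibly unbounded). $G$ is continuously differentiable with $0\le G(w)-G(v)-\langle\nabla G(v),w-v\rangle\le\frac{L_G}{2}\|w-v\|^2$ for all $w,v\in Z$. $H:Z\to\mathcal E$ satisfies $\langle H(w)-H(v),w-v\rangle\ge0$ and $\|H(w)-H(v)\|\le L_H\|w-v\|$ for all $w,v\in Z$. $J$ is a real-valued convex function on $Z$ having a subgradient $J'(u)\in\partial J(u)$ at each $u\in Z$. $VI(Z;G,H,J)$ is the variational inequality with operator $F(u)=\nabla G(u)+H(u)+J'(u)$; a strong solution is a point $u^*\in Z$ with $\langle F(u^* ),u^*-u\rangle\le0$ for all $u\in Z$. Prox-mapping. For $z\in Z$, $\eta\in\mathcal E$, $\gamma>0$, $P_z^{\gamma J}(\eta)=\operatorname{argmin}_{u\in Z}\{\langle\eta,u-z\rangle+V(z,u)+\gamma J(u)\}$, assumed to be well defined. Stochastic oracles. At the $i$-th call with input $x\in Z$, oracles $\mathcal{SO}_G$ and $\mathcal{SO}_H$ return $\mathcal G(x,\xi_i)$ and $\mathcal H(x,\zeta_i)$, where all $\xi_i,\zeta_i$ are independent random variables and $\mathbb E[\mathcal G(x,\xi_i)]=\nabla G(x)$, $\mathbb E[\mathcal H(x,\zeta_i)]=H(x)$.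 Assumption A1: $\mathbb E[\|\mathcal G(x,\xi_i)-\nabla G(x)\|^2]\le\sigma_G^2$ and $\mathbb E[\|\mathcal H(x,\zeta_i)-H(x)\|^2]\le\sigma_H^2$ for all $x\in Z$ and all $i$. Stochastic AMP method. Choose $r_1\in Z$ and set $w_1=w_1^{ag}=r_1$. For $t=1,2,\ldots$: $w_t^{md}=(1-\alpha_t)w_t^{ag}+\alpha_tr_t$; $w_{t+1}=P_{r_t}^{\gamma_tJ}(\gamma_t\mathcal H(r_t,\zeta_{2t-1})+\gamma_t\mathcal G(w_t^{md},\xi_t))$; $r_{t+1}=P_{r_t}^{\gamma_tJ}(\gamma_t\mathcal H(w_{t+1},\zeta_{2t})+\gamma_t\mathcal G(w_t^{md},\xi_t))$ (same sample $\mathcal G(w_t^{md},\xi_t)$); $w_{t+1}^{ag}=(1-\alpha_t)w_t^{ag}+\alpha_tw_{t+1}$. Gap function. $Q(\tilde u,u)=G(\tilde u)-G(u)+\langle H(u),\tilde u-u\rangle+J(\tilde u)-J(u)$ for $\tilde u,u\in Z$, and $\tilde g(\tilde u,\tilde v)=\sup_{u\in Z}\{Q(\tilde u,u)-\langle\tilde v,\tilde u-u\rangle\}$ for $\tilde u\in Z$, $\tilde v\in\mathcal E$. *)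

theory Defs
  imports "HOL-Probability.Probability"
begin

text \<open>A function on \<^term>\<open>Z\<close> need not extend to a neighbourhood, so the derivative is
  taken within \<^term>\<open>Z\<close>. If \<^term>\<open>Z\<close> has empty interior, the gradient is then not
  unique, and any continuous choice is admitted.\<close>

definition C1_gradient_on ::
    "'a::euclidean_space set \<Rightarrow> ('a \<Rightarrow> real) \<Rightarrow> ('a \<Rightarrow> 'a) \<Rightarrow> bool" where
  "C1_gradient_on Z G gradG \<longleftrightarrow>
     continuous_on Z gradG \<and>
     (\<forall>x\<in>Z. (G has_derivative (\<lambda>h. gradG x \<bullet> h)) (at x within Z))"

definition is_subgradient_on ::
    "'a::euclidean_space set \<Rightarrow> ('a \<Rightarrow> real) \<Rightarrow> 'a \<Rightarrow> 'a \<Rightarrow> bool" where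
  "is_subgradient_on Z J u s \<longleftrightarrow> (\<forall>w\<in>Z. J w \<ge> J u + s \<bullet> (w - u))"

definition strong_solution ::
    "'a::euclidean_space set \<Rightarrow> ('a \<Rightarrow> 'a) \<Rightarrow> 'a \<Rightarrow> bool" where
  "strong_solution Z F us \<longleftrightarrow> us \<in> Z \<and> (\<forall>u\<in>Z. F us \<bullet> (us - u) \<le> 0)"

definition prox_objective ::
    "('a::euclidean_space \<Rightarrow> 'a \<Rightarrow> real) \<Rightarrow> ('a \<Rightarrow> real) \<Rightarrow> real \<Rightarrow> 'a \<Rightarrow> 'a \<Rightarrow> 'a \<Rightarrow> real" where
  "prox_objective V J \<gamma> z \<eta> u = \<eta> \<bullet> (u - z) + V z u + \<gamma> * J u"

definition prox_map ::
    "'a::euclidean_space set \<Rightarrow> ('a \<Rightarrow> 'a \<Rightarrow> real) \<Rightarrow> ('a \<Rightarrow> real) \<Rightarrow> real \<Rightarrow> 'a \<Rightarrow> 'a \<Rightarrow> 'a" where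
  "prox_map Z V J \<gamma> z \<eta> = arg_min_on (prox_objective V J \<gamma> z \<eta>) Z"

definition prox_well_defined ::
    "'a::euclidean_space set \<Rightarrow> ('a \<Rightarrow> 'a \<Rightarrow> real) \<Rightarrow> ('a \<Rightarrow> real) \<Rightarrow> bool" where
  "prox_well_defined Z V J \<longleftrightarrow>
     (\<forall>z\<in>Z. \<forall>\<eta>. \<forall>\<gamma>>0. \<exists>!u. is_arg_min (prox_objective V J \<gamma> z \<eta>) (\<lambda>u. u \<in> Z) u)"

text \<open>Joint independence of two sequences with possibly different value types: the
  characterisation of \<open>indep_vars\<close> by generated set systems (\<open>indep_vars_def2\<close>), with
  the disjoint union of the two index sets as index set.\<close>

definition jointly_indep ::
    "'w measure \<Rightarrow> 'x measure \<Rightarrow> (nat \<Rightarrow> 'w \<Rightarrow> 'x) \<Rightarrow> 'y measure \<Rightarrow> (nat \<Rightarrow> 'w \<Rightarrow> 'y) \<Rightarrow> bool" where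
  "jointly_indep M X \<xi> Y \<zeta> \<longleftrightarrow>
     (\<forall>i\<ge>1. \<xi> i \<in> measurable M X) \<and>
     (\<forall>i\<ge>1. \<zeta> i \<in> measurable M Y) \<and>
     prob_space.indep_sets M
       (case_sum (\<lambda>i. {\<xi> i -` A \<inter> space M | A. A \<in> sets X})
                 (\<lambda>i. {\<zeta> i -` A \<inter> space M | A. A \<in> sets Y}))
       ({1..} <+> {1..})"

text \<open>Joint measurability is what makes the oracle answer at a random query point a random
  variable. Integrability is stated because the Bochner integral of a non-integrable
  function is 0 by convention.\<close>

definition unbiased_oracle ::
    "'w measure \<Rightarrow> 'x measure \<Rightarrow> (nat \<Rightarrow> 'w \<Rightarrow> 'x) \<Rightarrow> 'a::euclidean_space set
      \<Rightarrow> ('a \<Rightarrow> 'x \<Rightarrow> 'a) \<Rightarrow> ('a \<Rightarrow> 'a) \<Rightarrow> bool" where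
  "unbiased_oracle M X \<xi> Z \<O> F \<longleftrightarrow>
     (\<lambda>(x, s). \<O> x s) \<in> borel_measurable (restrict_space borel Z \<Otimes>\<^sub>M X) \<and>
     (\<forall>i\<ge>1. \<forall>x\<in>Z. integrable M (\<lambda>\<omega>. \<O> x (\<xi> i \<omega>)) \<and>
                    (\<integral>\<omega>. \<O> x (\<xi> i \<omega>) \<partial>M) = F x)"

definition bounded_variance ::
    "'w measure \<Rightarrow> (nat \<Rightarrow> 'w \<Rightarrow> 'x) \<Rightarrow> 'a::euclidean_space set
      \<Rightarrow> ('a \<Rightarrow> 'x \<Rightarrow> 'a) \<Rightarrow> ('a \<Rightarrow> 'a) \<Rightarrow> real \<Rightarrow> bool" where
  "bounded_variance M \<xi> Z \<O> F \<sigma> \<longleftrightarrow>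
     (\<forall>i\<ge>1. \<forall>x\<in>Z. integrable M (\<lambda>\<omega>. (norm (\<O> x (\<xi> i \<omega>) - F x))\<^sup>2) \<and>
                    (\<integral>\<omega>. (norm (\<O> x (\<xi> i \<omega>) - F x))\<^sup>2 \<partial>M) \<le> \<sigma>\<^sup>2)"

text \<open>One realisation of the stochastic AMP method: \<open>g t x\<close> and \<open>h i x\<close> are the answers of
  the two oracles at \<open>x\<close> in calls \<open>t\<close> and \<open>i\<close>. Indices start at 1; values at 0 are junk.\<close>

definition amp_run ::
    "'a::euclidean_space set \<Rightarrow> ('a \<Rightarrow> 'a \<Rightarrow> real) \<Rightarrow> ('a \<Rightarrow> real)
      \<Rightarrow> (nat \<Rightarrow> real) \<Rightarrow> (nat \<Rightarrow> real) \<Rightarrow> 'a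
      \<Rightarrow> (nat \<Rightarrow> 'a \<Rightarrow> 'a) \<Rightarrow> (nat \<Rightarrow> 'a \<Rightarrow> 'a)
      \<Rightarrow> (nat \<Rightarrow> 'a) \<Rightarrow> (nat \<Rightarrow> 'a) \<Rightarrow> (nat \<Rightarrow> 'a) \<Rightarrow> (nat \<Rightarrow> 'a) \<Rightarrow> bool" where
  "amp_run Z V J \<alpha> \<gamma> r1 g h r w wmd wag \<longleftrightarrow>
     r 1 = r1 \<and> w 1 = r1 \<and> wag 1 = r1 \<and>
     (\<forall>t\<ge>1.
        wmd t = (1 - \<alpha> t) *\<^sub>R wag t + \<alpha> t *\<^sub>R r t \<and>
        w (t + 1) = prox_map Z V J (\<gamma> t) (r t)
          (\<gamma> t *\<^sub>R h (2 * t - 1) (r t) + \<gamma> t *\<^sub>R g t (wmd t)) \<and>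
        r (t + 1) = prox_map Z V J (\<gamma> t) (r t)
          (\<gamma> t *\<^sub>R h (2 * t) (w (t + 1)) + \<gamma> t *\<^sub>R g t (wmd t)) \<and>
        wag (t + 1) = (1 - \<alpha> t) *\<^sub>R wag t + \<alpha> t *\<^sub>R w (t + 1))"

definition gap_Q ::
    "('a::euclidean_space \<Rightarrow> real) \<Rightarrow> ('a \<Rightarrow> 'a) \<Rightarrow> ('a \<Rightarrow> real) \<Rightarrow> 'a \<Rightarrow> 'a \<Rightarrow> real" where
  "gap_Q G H J ut u = G ut - G u + H u \<bullet> (ut - u) + J ut - J u"

text \<open>Extended-real valued, since the supremum may be infinite when \<^term>\<open>Z\<close> is
  unbounded.\<close>

definition perturbed_gap ::
    "'a::euclidean_space set \<Rightarrow> ('a \<Rightarrow> real) \<Rightarrow> ('a \<Rightarrow> 'a) \<Rightarrow> ('a \<Rightarrow> real)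
      \<Rightarrow> 'a \<Rightarrow> 'a \<Rightarrow> ereal" where
  "perturbed_gap Z G H J ut vt =
     (SUP u\<in>Z. ereal (gap_Q G H J ut u - vt \<bullet> (ut - u)))"

end

theory Submission imports Defs begin

text \<open>Let \<open>S t = \<gamma> 1 + \<dots> + \<gamma> t\<close>. The condition on the weights says \<open>\<alpha> t * S t = \<gamma> t\<close>, so that
  the aggregated point is the \<open>\<gamma>\<close>-weighted average of the extrapolated points. Adding the optimality
  conditions of the two prox steps to the smoothness inequality for \<open>G\<close> gives, for every \<open>u\<close> in
  \<open>Z\<close>, a telescoping bound on \<open>S t * Q(wag (t + 1), u)\<close> whose right-hand side depends on \<open>u\<close> only
  through \<open>\<parallel>r1 - u\<parallel>\<^sup>2 - \<parallel>r (t + 1) - u\<parallel>\<^sup>2\<close> and through the inner product of \<open>u\<close> with the accumulated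
  oracle error. This is affine in \<open>u\<close>, and the perturbation \<open>v\<close> is chosen to absorb the
  linear part; what remains is the residual, which is nonnegative because \<open>Q(u, u) = 0\<close>.
  In expectation the errors are martingale differences, and the same telescoping bound at
  \<open>u = us\<close>, where \<open>Q \<ge> 0\<close>, controls the distance of the iterates from the solution.\<close>

section \<open>The prox-mapping\<close>

text \<open>One sample of \<open>\<G>\<close> drives both prox steps of an iteration. Hence
  \<open>w (t + 1)\<close> already depends on it, and the error of \<open>\<G>\<close> has zero mean
  only against \<open>r t\<close>. The leftover product with \<open>w (t + 1) - r t\<close> is paid
  for by the term \<open>(norm (w (t + 1) - r t))\<^sup>2 / 2\<close> that the prox steps leave
  over. This budget is split in three: \<open>c\<^sup>2 / 2\<close> covers the smoothness of
  \<open>G\<close> and the Lipschitz constant of \<open>H\<close>, \<open>(1 - q) / 2\<close> covers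
  the error of \<open>\<G>\<close>, and \<open>(q - c\<^sup>2) / 2\<close> survives. The surviving
  share matters because the telescoped bound controls the points \<open>r t\<close>, whereas the
  aggregated point averages the points \<open>w (t + 1)\<close>; \<open>\<theta>\<close> is the
  price of passing from one to the other.

  As \<open>Z\<close> may be unbounded, zero mean can be invoked only once the iterates are known to
  be square integrable. A cruder recursion, which estimates every product with an error by squares,
  supplies this beforehand.\<close>

lemma prox_map_in:
  assumes "prox_well_defined Z V J" "z \<in> Z" "0 < \<gamma>"
  shows "prox_map Z V J \<gamma> z \<eta> \<in> Z"
    and "u \<in> Z \<Longrightarrow> prox_objective V J \<gamma> z \<eta> (prox_map Z V J \<gamma> z \<eta>) \<le> prox_objective V J \<gamma> z \<eta> u"
proof -
  have "\<exists>p. is_arg_min (prox_objective V J \<gamma> z \<eta>) (\<lambda>u. u \<in> Z) p"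
    using assms unfolding prox_well_defined_def by blast
  then have *: "is_arg_min (prox_objective V J \<gamma> z \<eta>) (\<lambda>u. u \<in> Z) (prox_map Z V J \<gamma> z \<eta>)"
    unfolding prox_map_def arg_min_on_def arg_min_def by (rule someI_ex)
  show "prox_map Z V J \<gamma> z \<eta> \<in> Z"
    and "u \<in> Z \<Longrightarrow> prox_objective V J \<gamma> z \<eta> (prox_map Z V J \<gamma> z \<eta>) \<le> prox_objective V J \<gamma> z \<eta> u"
    using * by (auto simp: is_arg_min_linorder)
qed

text \<open>Obtained without differentiating: the minimiser \<open>p\<close> is compared with a
  point at fraction \<open>l\<close> of the segment from \<open>p\<close> to \<open>u\<close>.
  Convexity bounds \<open>J\<close> there, the linear terms are of order \<open>l\<close>, and the
  quadratic remainder disappears after division by \<open>l\<close> as \<open>l\<close> tends to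
  0.\<close>

lemma prox_map_variational:
  fixes Z :: "'a::euclidean_space set"
    and \<eta> :: 'a
  assumes "convex Z" "convex_on Z J" "\<forall>r\<in>Z. \<forall>z\<in>Z. V r z = (norm (z - r))\<^sup>2 / 2"
    and "prox_well_defined Z V J" "z \<in> Z" "0 < \<gamma>" "u \<in> Z"
  defines "p \<equiv> prox_map Z V J \<gamma> z \<eta>"
  shows "(\<eta> + p - z) \<bullet> (p - u) + \<gamma> * (J p - J u) \<le> 0"
proof (rule field_le_epsilon)
  fix e :: real assume "0 < e"
  have p: "p \<in> Z" unfolding p_def by (rule prox_map_in(1)[OF assms(4-6)])
  \<comment> \<open>The quotient keeps \<open>l * (norm (u - p))\<^sup>2\<close> below
    \<open>e\<close>; the added 1 covers \<open>u = p\<close>, and the cap at 1 keeps the comparison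
    point on the segment.\<close>
  define l where "l = min 1 (e / (1 + (norm (u - p))\<^sup>2))"
  have pos: "0 < 1 + (norm (u - p))\<^sup>2" by (smt (verit) zero_le_power2)
  have l: "0 < l" "l \<le> 1" using \<open>0 < e\<close> pos by (auto simp: l_def)
  have "l * (norm (u - p))\<^sup>2 \<le> e / (1 + (norm (u - p))\<^sup>2) * (norm (u - p))\<^sup>2"
    unfolding l_def by (intro mult_right_mono) auto
  also have "\<dots> \<le> e" using \<open>0 < e\<close> pos by (simp add: field_simps)
  finally have le: "l * (norm (u - p))\<^sup>2 \<le> e" .
  let ?x = "(1 - l) *\<^sub>R p + l *\<^sub>R u"
  have x: "?x \<in> Z" using assms(1) p \<open>u \<in> Z\<close> l by (simp add: convex_alt)
  have Jx: "J ?x \<le> (1 - l) * J p + l * J u"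
    using convex_onD[OF assms(2), of l p u] l p \<open>u \<in> Z\<close> by simp
  have "prox_objective V J \<gamma> z \<eta> p \<le> prox_objective V J \<gamma> z \<eta> ?x"
    unfolding p_def by (rule prox_map_in(2)[OF assms(4-6)]) (use x in \<open>simp add: p_def\<close>)
  then have "\<eta> \<bullet> (p - z) + (norm (p - z))\<^sup>2 / 2 + \<gamma> * J p
      \<le> \<eta> \<bullet> (?x - z) + (norm (?x - z))\<^sup>2 / 2 + \<gamma> * ((1 - l) * J p + l * J u)"
    using mult_left_mono[OF Jx less_imp_le[OF \<open>0 < \<gamma>\<close>]] bspec[OF bspec[OF assms(3) \<open>z \<in> Z\<close>] p]
      bspec[OF bspec[OF assms(3) \<open>z \<in> Z\<close>] x] unfolding prox_objective_def by linarith
  moreover have "\<eta> \<bullet> (?x - z) = \<eta> \<bullet> (p - z) + l * (\<eta> \<bullet> (u - p))"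
    by (simp add: algebra_simps)
  moreover have "(norm (?x - z))\<^sup>2 = (norm (p - z))\<^sup>2 + 2 * l * ((p - z) \<bullet> (u - p)) + l\<^sup>2 * (norm (u - p))\<^sup>2"
  proof -
    have "?x - z = (p - z) + l *\<^sub>R (u - p)" by (simp add: algebra_simps)
    then show ?thesis
      unfolding power2_norm_eq_inner by (simp only: inner_add inner_scaleR) (simp add: inner_commute power2_eq_square distrib_left)
  qed
  moreover have "(\<eta> + p - z) \<bullet> (p - u) = - (\<eta> \<bullet> (u - p)) - (p - z) \<bullet> (u - p)"
    by (simp add: inner_diff inner_add)
  ultimately have "l * ((\<eta> + p - z) \<bullet> (p - u) + \<gamma> * (J p - J u)) \<le> l * (l * (norm (u - p))\<^sup>2 / 2)"
    by (simp add: algebra_simps power2_eq_square)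
  then have "(\<eta> + p - z) \<bullet> (p - u) + \<gamma> * (J p - J u) \<le> l * (norm (u - p))\<^sup>2 / 2"
    using l by simp
  then show "(\<eta> + p - z) \<bullet> (p - u) + \<gamma> * (J p - J u) \<le> 0 + e"
    using le \<open>0 < e\<close> by simp
qed

text \<open>With a Euclidean prox-function, the prox-mapping depends on \<open>z\<close> and \<open>\<eta>\<close> only through
  \<open>z - \<eta>\<close>, and is nonexpansive in it.\<close>

lemma prox_map_nonexpansive:
  fixes Z :: "'a::euclidean_space set"
  assumes "convex Z" "convex_on Z J" "\<forall>r\<in>Z. \<forall>z\<in>Z. V r z = (norm (z - r))\<^sup>2 / 2"
    and "prox_well_defined Z V J" "0 < \<gamma>" "z \<in> Z" "z' \<in> Z"
  shows "norm (prox_map Z V J \<gamma> z \<eta> - prox_map Z V J \<gamma> z' \<eta>') \<le> norm ((z - \<eta>) - (z' - \<eta>'))"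
proof -
  define p p' where "p = prox_map Z V J \<gamma> z \<eta>" and "p' = prox_map Z V J \<gamma> z' \<eta>'"
  have Z: "p \<in> Z" "p' \<in> Z" unfolding p_def p'_def using assms by (auto intro: prox_map_in)
  have 1: "(\<eta> + p - z) \<bullet> (p - p') + \<gamma> * (J p - J p') \<le> 0"
    unfolding p_def using prox_map_variational[OF assms(1-4,6,5) Z(2)] .
  have 2: "(\<eta>' + p' - z') \<bullet> (p' - p) + \<gamma> * (J p' - J p) \<le> 0"
    unfolding p'_def using prox_map_variational[OF assms(1-4,7,5) Z(1)] .
  have "norm (p - p') * norm (p - p') = (p - p') \<bullet> (p - p')"
    by (simp add: power2_norm_eq_inner flip: power2_eq_square)
  \<comment> \<open>Each minimiser was tested at the other one; in the sum of \<open>1\<close> and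
    \<open>2\<close> the values of \<open>J\<close> cancel.\<close>
  also have "\<dots> \<le> ((z - \<eta>) - (z' - \<eta>')) \<bullet> (p - p')"
    using 1 2 by (simp add: inner_diff inner_add algebra_simps)
  also have "\<dots> \<le> norm ((z - \<eta>) - (z' - \<eta>')) * norm (p - p')"
    by (rule norm_cauchy_schwarz)
  finally show ?thesis
    unfolding p_def[symmetric] p'_def[symmetric]
    by (metis mult_right_le_imp_le norm_ge_zero norm_zero order_antisym_conv not_le
        zero_less_norm_iff)
qed

text \<open>No measurable selection is involved: the prox-mapping is a Lipschitz function of the
  single vector \<open>z - \<eta>\<close>, and fixing one base point of \<open>Z\<close> defines
  that function on the whole space.\<close>

lemma measurable_prox_map:
  fixes Z :: "'a::euclidean_space set"
  assumes "convex Z" "convex_on Z J" "\<forall>r\<in>Z. \<forall>z\<in>Z. V r z = (norm (z - r))\<^sup>2 / 2"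
    and "prox_well_defined Z V J" "0 < \<gamma>"
    and [measurable]: "z \<in> borel_measurable N" "\<eta> \<in> borel_measurable N"
    and Z: "\<And>\<omega>. \<omega> \<in> space N \<Longrightarrow> z \<omega> \<in> Z"
  shows "(\<lambda>\<omega>. prox_map Z V J \<gamma> (z \<omega>) (\<eta> \<omega>)) \<in> borel_measurable N"
proof (cases "Z = {}")
  case True
  then have "space N = {}" using Z by auto
  then show ?thesis by (simp add: measurable_def)
next
  case False
  then obtain z0 where z0: "z0 \<in> Z" by auto
  define f where "f y = prox_map Z V J \<gamma> z0 (z0 - y)" for y
  have "1-lipschitz_on UNIV f"
  proof (rule lipschitz_onI)
    fix x y
    show "dist (f x) (f y) \<le> 1 * dist x y"
      using prox_map_nonexpansive[OF assms(1-5) z0 z0, of "z0 - x" "z0 - y"]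
      by (simp add: f_def dist_norm)
  qed simp
  then have "f \<in> borel_measurable borel"
    by (intro borel_measurable_continuous_onI lipschitz_on_continuous_on)
  then have "(\<lambda>\<omega>. f (z \<omega> - \<eta> \<omega>)) \<in> borel_measurable N" by measurable
  \<comment> \<open>Both pairs of arguments have the same difference, so the nonexpansiveness bound
    is 0.\<close>
  moreover have "f (z \<omega> - \<eta> \<omega>) = prox_map Z V J \<gamma> (z \<omega>) (\<eta> \<omega>)" if "\<omega> \<in> space N" for \<omega>
    using prox_map_nonexpansive[OF assms(1-5) z0 Z[OF that], of "z0 - (z \<omega> - \<eta> \<omega>)" "\<eta> \<omega>"]
    by (simp add: f_def)
  ultimately show ?thesis by (simp cong: measurable_cong)
qed

section \<open>Pathwise estimates\<close>

text \<open>The hypotheses in the form in which the estimates use them: \<open>\<alpha>_eq\<close>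
  condenses the recursion for the weights, and \<open>gap_us\<close> is what a strong solution
  yields once \<open>G\<close> and \<open>J\<close> are convex.\<close>

locale amp_problem =
  fixes Z :: "'a::euclidean_space set" and G J :: "'a \<Rightarrow> real" and gradG H :: "'a \<Rightarrow> 'a"
    and L_G L_H :: real and V :: "'a \<Rightarrow> 'a \<Rightarrow> real" and \<alpha> \<gamma> :: "nat \<Rightarrow> real" and c q :: real
    and us :: 'a
  assumes convex_Z: "convex Z"
    and G_lower: "\<And>w v. w \<in> Z \<Longrightarrow> v \<in> Z \<Longrightarrow> G v + gradG v \<bullet> (w - v) \<le> G w"
    and G_upper: "\<And>w v. w \<in> Z \<Longrightarrow> v \<in> Z \<Longrightarrow>
      G w \<le> G v + gradG v \<bullet> (w - v) + L_G / 2 * (norm (w - v))\<^sup>2"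
    and H_monotone: "\<And>w v. w \<in> Z \<Longrightarrow> v \<in> Z \<Longrightarrow> (H w - H v) \<bullet> (w - v) \<ge> 0"
    and H_Lipschitz: "\<And>w v. w \<in> Z \<Longrightarrow> v \<in> Z \<Longrightarrow> norm (H w - H v) \<le> L_H * norm (w - v)"
    and J_convex: "convex_on Z J"
    and V: "\<forall>r\<in>Z. \<forall>z\<in>Z. V r z = (norm (z - r))\<^sup>2 / 2"
    and prox: "prox_well_defined Z V J"
    and \<gamma>_pos: "\<And>t. t \<ge> 1 \<Longrightarrow> 0 < \<gamma> t"
    and \<alpha>_eq: "\<And>t. t \<ge> 1 \<Longrightarrow> \<alpha> t * (\<Sum>i=1..t. \<gamma> i) = \<gamma> t"
    and c2_less: "c\<^sup>2 < q" and q_less: "q < 1"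
    and step: "\<And>t. t \<ge> 1 \<Longrightarrow> L_G * \<alpha> t * \<gamma> t + 3 * L_H\<^sup>2 * (\<gamma> t)\<^sup>2 \<le> c\<^sup>2"
    and us: "us \<in> Z"
    and gap_us: "\<And>u. u \<in> Z \<Longrightarrow> 0 \<le> gap_Q G H J u us"
begin

abbreviation S :: "nat \<Rightarrow> real" where "S t \<equiv> \<Sum>i=1..t. \<gamma> i"

lemma S_Suc: "t \<ge> 1 \<Longrightarrow> S t = S (t - 1) + \<gamma> t"
  by (cases t) auto

lemma S_nonneg: "0 \<le> S t"
  using \<gamma>_pos by (intro sum_nonneg) (auto intro: less_imp_le)

lemma S_pos: "t \<ge> 1 \<Longrightarrow> 0 < S t"
  using S_Suc[of t] S_nonneg[of "t - 1"] \<gamma>_pos[of t] by simp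

lemma \<alpha>_ge: "t \<ge> 1 \<Longrightarrow> 0 \<le> \<alpha> t"
  using \<alpha>_eq[of t] \<gamma>_pos[of t] S_pos[of t] by (smt (verit) mult_nonpos_nonneg)

lemma \<alpha>_le: assumes "t \<ge> 1" shows "\<alpha> t \<le> 1"
proof -
  have "\<alpha> t * S t \<le> 1 * S t"
    using \<alpha>_eq[OF assms] S_Suc[OF assms] S_nonneg[of "t - 1"] by simp
  then show ?thesis using S_pos[OF assms] by simp
qed

lemma S_one_minus_\<alpha>: "t \<ge> 1 \<Longrightarrow> S t * (1 - \<alpha> t) = S (t - 1)"
  using \<alpha>_eq[of t] S_Suc[of t] by (simp add: algebra_simps)

lemma H_Lipschitz2:
  assumes "w \<in> Z" "v \<in> Z" shows "(norm (H w - H v))\<^sup>2 \<le> L_H\<^sup>2 * (norm (w - v))\<^sup>2"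
  using power_mono[OF H_Lipschitz[OF assms], of 2] by (simp add: power_mult_distrib)

text \<open>\<open>L_G\<close> may be negative, but only if \<open>Z\<close> is a single point.\<close>

lemma L_G_nonneg: "w \<in> Z \<Longrightarrow> v \<in> Z \<Longrightarrow> 0 \<le> L_G * (norm (w - v))\<^sup>2"
  using G_lower[of w v] G_upper[of w v] by simp

text \<open>All comparisons of \<open>G\<close> are made from \<open>md\<close>: smoothness bounds
  \<open>G x'\<close> from above, convexity bounds \<open>G x\<close> and \<open>G u\<close> from
  below, with weights \<open>1 - \<alpha> t\<close> and \<open>\<alpha> t\<close>. Monotonicity
  replaces \<open>H u\<close> by \<open>H w\<close>, the operator value that the algorithm samples.
  Multiplication by \<open>S t\<close> turns \<open>1 - \<alpha> t\<close> into
  \<open>S (t - 1)\<close>, which makes the bound telescope.\<close>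

lemma gap_step:
  assumes t: "t \<ge> 1" and Z: "x \<in> Z" "r \<in> Z" "w \<in> Z" "u \<in> Z"
    and md: "md = (1 - \<alpha> t) *\<^sub>R x + \<alpha> t *\<^sub>R r"
    and x': "x' = (1 - \<alpha> t) *\<^sub>R x + \<alpha> t *\<^sub>R w"
  shows "S t * gap_Q G H J x' u \<le> S (t - 1) * gap_Q G H J x u
    + \<gamma> t * ((gradG md + H w) \<bullet> (w - u) + J w - J u) + L_G * \<alpha> t * \<gamma> t / 2 * (norm (w - r))\<^sup>2"
proof -
  let ?a = "\<alpha> t"
  have a: "0 \<le> ?a" "?a \<le> 1" using \<alpha>_ge \<alpha>_le t by auto
  have in_Z: "md \<in> Z" "x' \<in> Z"
    unfolding md x' using convex_Z Z a by (auto simp: convex_alt)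
  \<comment> \<open>The points \<open>md\<close> and \<open>x'\<close> use the same weights so that
    their difference is only a fraction \<open>\<alpha> t\<close> of the prox displacement.\<close>
  have xw: "x' - md = ?a *\<^sub>R (w - r)" unfolding md x' by (simp add: algebra_simps)
  have "G x' \<le> G md + gradG md \<bullet> (x' - md) + L_G / 2 * (?a\<^sup>2 * (norm (w - r))\<^sup>2)"
    using G_upper[OF in_Z(2,1)] by (simp add: xw power_mult_distrib)
  moreover have "gradG md \<bullet> (x' - md)
      = (1 - ?a) * (gradG md \<bullet> (x - md)) + ?a * (gradG md \<bullet> (u - md)) + ?a * (gradG md \<bullet> (w - u))"
    unfolding x' by (simp add: inner_diff inner_add algebra_simps)
  moreover have "(1 - ?a) * (G md + gradG md \<bullet> (x - md)) \<le> (1 - ?a) * G x"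
    using a G_lower[OF Z(1) in_Z(1)] by (intro mult_left_mono) auto
  moreover have "?a * (G md + gradG md \<bullet> (u - md)) \<le> ?a * G u"
    using a G_lower[OF Z(4) in_Z(1)] by (intro mult_left_mono) auto
  ultimately have G: "G x' \<le> (1 - ?a) * G x + ?a * G u + ?a * (gradG md \<bullet> (w - u))
      + L_G / 2 * (?a\<^sup>2 * (norm (w - r))\<^sup>2)"
    by (simp add: algebra_simps)
  have "H u \<bullet> (x' - u) = (1 - ?a) * (H u \<bullet> (x - u)) + ?a * (H u \<bullet> (w - u))"
    unfolding x' by (simp add: inner_diff inner_add algebra_simps)
  moreover have "?a * (H u \<bullet> (w - u)) \<le> ?a * (H w \<bullet> (w - u))"
    using a H_monotone[OF Z(3,4)] by (intro mult_left_mono) (auto simp: inner_diff)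
  moreover have "J x' \<le> (1 - ?a) * J x + ?a * J w"
    unfolding x' using convex_onD[OF J_convex, of ?a x w] a Z by simp
  ultimately have "gap_Q G H J x' u \<le> (1 - ?a) * gap_Q G H J x u
      + ?a * ((gradG md + H w) \<bullet> (w - u) + J w - J u) + L_G / 2 * (?a\<^sup>2 * (norm (w - r))\<^sup>2)"
    using G unfolding gap_Q_def by (simp add: algebra_simps)
  then have "S t * gap_Q G H J x' u \<le> S t * ((1 - ?a) * gap_Q G H J x u
      + ?a * ((gradG md + H w) \<bullet> (w - u) + J w - J u) + L_G / 2 * (?a\<^sup>2 * (norm (w - r))\<^sup>2))"
    by (intro mult_left_mono S_nonneg)
  \<comment> \<open>One factor of the squared weight merges with \<open>S t\<close> into
    \<open>\<gamma> t\<close>; the smoothness term thus carries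
    \<open>L_G * \<alpha> t * \<gamma> t\<close>, which the step condition limits.\<close>
  also have "\<dots> = (S t * (1 - ?a)) * gap_Q G H J x u
      + (?a * S t) * ((gradG md + H w) \<bullet> (w - u) + J w - J u)
      + L_G * ?a * (?a * S t) / 2 * (norm (w - r))\<^sup>2"
    by (simp add: algebra_simps power2_eq_square)
  finally show ?thesis by (simp only: S_one_minus_\<alpha>[OF t] \<alpha>_eq[OF t])
qed

end

section \<open>Elementary inequalities for squared norms\<close>

lemma norm_add3_squared_le:
  fixes x y z :: "'a::real_inner"
  shows "(norm (x + y + z))\<^sup>2 \<le> 3 * ((norm x)\<^sup>2 + (norm y)\<^sup>2 + (norm z)\<^sup>2)"
proof -
  have "0 \<le> (norm (x - y))\<^sup>2 + (norm (y - z))\<^sup>2 + (norm (x - z))\<^sup>2" by simp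
  then show ?thesis
    by (simp add: power2_norm_eq_inner inner_add inner_diff inner_commute)
qed

lemma norm_add_squared_le:
  fixes x y :: "'a::real_inner"
  shows "(norm (x + y))\<^sup>2 \<le> 2 * ((norm x)\<^sup>2 + (norm y)\<^sup>2)"
proof -
  have "0 \<le> (norm (x - y))\<^sup>2" by simp
  then show ?thesis
    by (simp add: power2_norm_eq_inner inner_add inner_diff inner_commute)
qed

text \<open>Young's inequality; the weight \<open>a\<close> decides how much of the second square is
  spent.\<close>

lemma inner_le_weighted_squares:
  fixes x y :: "'a::real_inner"
  assumes "0 < a"
  shows "x \<bullet> y \<le> (norm x)\<^sup>2 / (2 * a) + a / 2 * (norm y)\<^sup>2"
proof -
  have "0 \<le> (norm (x - a *\<^sub>R y))\<^sup>2" by simp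
  then have "2 * a * (x \<bullet> y) \<le> (norm x)\<^sup>2 + a * a * (norm y)\<^sup>2"
    by (simp add: power2_norm_eq_inner inner_diff inner_commute algebra_simps)
  then have "(2 * a * (x \<bullet> y)) / (2 * a) \<le> ((norm x)\<^sup>2 + a * a * (norm y)\<^sup>2) / (2 * a)"
    using assms by (intro divide_right_mono) auto
  then show ?thesis using assms by (simp add: add_divide_distrib)
qed

section \<open>Estimates along a single realisation of the method\<close>

locale amp_path = amp_problem Z G J gradG H L_G L_H V \<alpha> \<gamma> c q us
  for Z :: "'a::euclidean_space set" and G J gradG H L_G L_H V \<alpha> \<gamma> c q us +
  fixes r1 :: 'a and g h :: "nat \<Rightarrow> 'a \<Rightarrow> 'a" and r w wmd wag :: "nat \<Rightarrow> 'a"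
  assumes r1: "r1 \<in> Z"
    and run: "amp_run Z V J \<alpha> \<gamma> r1 g h r w wmd wag"
begin

definition errH1 :: "nat \<Rightarrow> 'a" where "errH1 t = h (2 * t - 1) (r t) - H (r t)"
definition errH2 :: "nat \<Rightarrow> 'a" where "errH2 t = h (2 * t) (w (t + 1)) - H (w (t + 1))"
definition errG :: "nat \<Rightarrow> 'a" where "errG t = g t (wmd t) - gradG (wmd t)"

lemma run1: "r 1 = r1" "wag 1 = r1"
  using run by (auto simp: amp_run_def)

lemma run_step:
  assumes "t \<ge> 1"
  shows "wmd t = (1 - \<alpha> t) *\<^sub>R wag t + \<alpha> t *\<^sub>R r t"
    and "w (t + 1) = prox_map Z V J (\<gamma> t) (r t) (\<gamma> t *\<^sub>R h (2 * t - 1) (r t) + \<gamma> t *\<^sub>R g t (wmd t))"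
    and "r (t + 1) = prox_map Z V J (\<gamma> t) (r t) (\<gamma> t *\<^sub>R h (2 * t) (w (t + 1)) + \<gamma> t *\<^sub>R g t (wmd t))"
    and "wag (t + 1) = (1 - \<alpha> t) *\<^sub>R wag t + \<alpha> t *\<^sub>R w (t + 1)"
  using run assms by (auto simp: amp_run_def)

lemma step_in_Z:
  assumes "t \<ge> 1" "r t \<in> Z" "wag t \<in> Z"
  shows "wmd t \<in> Z" "w (t + 1) \<in> Z" "r (t + 1) \<in> Z" "wag (t + 1) \<in> Z"
proof -
  show w: "w (t + 1) \<in> Z" and "r (t + 1) \<in> Z"
    unfolding run_step(2,3)[OF assms(1)]
    using prox_map_in(1)[OF prox assms(2) \<gamma>_pos[OF assms(1)]] by auto
  show "wmd t \<in> Z" "wag (t + 1) \<in> Z"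
    unfolding run_step(1,4)[OF assms(1)]
    using convex_Z w assms \<alpha>_ge[OF assms(1)] \<alpha>_le[OF assms(1)]
    by (auto simp: convex_alt)
qed

lemma r_wag_in_Z: "t \<ge> 1 \<Longrightarrow> r t \<in> Z \<and> wag t \<in> Z"
proof (induction t rule: dec_induct)
  case base then show ?case using run1 r1 by simp
next
  case (step t) then show ?case using step_in_Z(3,4)[of t] by simp
qed

lemma in_Z:
  assumes "t \<ge> 1"
  shows "r t \<in> Z" "wag t \<in> Z" "wmd t \<in> Z" "w (t + 1) \<in> Z" "r (t + 1) \<in> Z" "wag (t + 1) \<in> Z"
  using step_in_Z[of t] r_wag_in_Z[of t] assms by auto

text \<open>Inserting \<open>H\<close> at both query points splits the difference of the answers
  into a Lipschitz part and two errors. The three-term split is the origin of the 3 in the step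
  condition.\<close>

lemma operator_difference:
  assumes t: "t \<ge> 1"
  shows "(\<gamma> t)\<^sup>2 * (norm (h (2 * t) (w (t + 1)) - h (2 * t - 1) (r t)))\<^sup>2
    \<le> 3 * L_H\<^sup>2 * (\<gamma> t)\<^sup>2 * (norm (w (t + 1) - r t))\<^sup>2
      + 3 * (\<gamma> t)\<^sup>2 * ((norm (errH1 t))\<^sup>2 + (norm (errH2 t))\<^sup>2)"
proof -
  have "h (2 * t) (w (t + 1)) - h (2 * t - 1) (r t) = (H (w (t + 1)) - H (r t)) + (- errH1 t) + errH2 t"
    by (simp add: errH1_def errH2_def)
  then have "(norm (h (2 * t) (w (t + 1)) - h (2 * t - 1) (r t)))\<^sup>2
    \<le> 3 * ((norm (H (w (t + 1)) - H (r t)))\<^sup>2 + (norm (errH1 t))\<^sup>2 + (norm (errH2 t))\<^sup>2)"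
    using norm_add3_squared_le[of "H (w (t + 1)) - H (r t)" "- errH1 t" "errH2 t"] by simp
  also have "\<dots> \<le> 3 * (L_H\<^sup>2 * (norm (w (t + 1) - r t))\<^sup>2 + (norm (errH1 t))\<^sup>2 + (norm (errH2 t))\<^sup>2)"
    using H_Lipschitz2[OF in_Z(4,1)[OF t]] by simp
  finally show ?thesis
    using mult_left_mono[of _ _ "(\<gamma> t)\<^sup>2"] by (fastforce simp: algebra_simps)
qed

text \<open>Both prox steps start at \<open>r t\<close> and use the same answer of \<open>g\<close>,
  so nonexpansiveness leaves only the difference of the two answers of \<open>h\<close>.\<close>

lemma extrapolation_gap:
  assumes t: "t \<ge> 1"
  shows "(norm (w (t + 1) - r (t + 1)))\<^sup>2 \<le> c\<^sup>2 * (norm (w (t + 1) - r t))\<^sup>2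
      + 3 * (\<gamma> t)\<^sup>2 * ((norm (errH1 t))\<^sup>2 + (norm (errH2 t))\<^sup>2)"
proof -
  let ?hw = "h (2 * t) (w (t + 1))" and ?hr = "h (2 * t - 1) (r t)"
  have "norm (w (t + 1) - r (t + 1)) \<le> norm (\<gamma> t *\<^sub>R (?hw - ?hr))"
    using prox_map_nonexpansive[OF convex_Z J_convex V prox \<gamma>_pos[OF t] in_Z(1)[OF t] in_Z(1)[OF t],
        of "\<gamma> t *\<^sub>R ?hr + \<gamma> t *\<^sub>R g t (wmd t)" "\<gamma> t *\<^sub>R ?hw + \<gamma> t *\<^sub>R g t (wmd t)"]
    unfolding run_step(2,3)[OF t, symmetric] by (simp add: algebra_simps)
  from power_mono[OF this, of 2]
  have "(norm (w (t + 1) - r (t + 1)))\<^sup>2 \<le> (\<gamma> t)\<^sup>2 * (norm (?hw - ?hr))\<^sup>2"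
    by (simp add: power_mult_distrib)
  moreover have "3 * L_H\<^sup>2 * (\<gamma> t)\<^sup>2 * (norm (w (t + 1) - r t))\<^sup>2 \<le> c\<^sup>2 * (norm (w (t + 1) - r t))\<^sup>2"
  proof -
    \<comment> \<open>Since \<open>L_G\<close> may be negative, its term cannot be dropped from the
      step condition itself, only after multiplication by the squared distance.\<close>
    have "0 \<le> \<alpha> t * \<gamma> t * (L_G * (norm (w (t + 1) - r t))\<^sup>2)"
      using \<alpha>_ge[OF t] \<gamma>_pos[OF t] L_G_nonneg[OF in_Z(4,1)[OF t]]
      by (metis mult_nonneg_nonneg less_imp_le)
    then show ?thesis
      using mult_right_mono[OF step[OF t], of "(norm (w (t + 1) - r t))\<^sup>2"]
      by (simp add: algebra_simps)
  qed
  ultimately show ?thesis using operator_difference[OF t] by linarith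
qed

text \<open>The error cost of one iteration: 3/2 is half the 3 of
  \<open>operator_difference\<close>, and the weight of \<open>errG\<close> comes from Young's
  inequality with \<open>1 - q\<close>.\<close>

definition noise :: "nat \<Rightarrow> real" where
  "noise t = 3 / 2 * (\<gamma> t)\<^sup>2 * ((norm (errH1 t))\<^sup>2 + (norm (errH2 t))\<^sup>2)
     + (\<gamma> t)\<^sup>2 / (2 * (1 - q)) * (norm (errG t))\<^sup>2"

text \<open>The core inequality. The optimality conditions of the two prox steps are added,
  \<open>gap_step\<close> converts the operator values into gaps, and the positive term in
  \<open>norm (w (t + 1) - r t)\<close> absorbs the smoothness, Lipschitz and \<open>errG\<close>
  terms, keeping the share \<open>(q - c\<^sup>2) / 2\<close>.\<close>

lemma one_step:
  assumes t: "t \<ge> 1" and u: "u \<in> Z"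
  shows "S t * gap_Q G H J (wag (t + 1)) u + (norm (r (t + 1) - u))\<^sup>2 / 2
      + (q - c\<^sup>2) / 2 * (norm (w (t + 1) - r t))\<^sup>2
    \<le> S (t - 1) * gap_Q G H J (wag t) u + (norm (r t - u))\<^sup>2 / 2 + noise t
      - \<gamma> t * (errH2 t \<bullet> (w (t + 1) - u) + errG t \<bullet> (r t - u))"
proof -
  let ?hw = "h (2 * t) (w (t + 1))" and ?hr = "h (2 * t - 1) (r t)" and ?g = "g t (wmd t)"
  let ?w = "w (t + 1)" and ?r = "r t" and ?r' = "r (t + 1)"
  note pv = prox_map_variational[OF convex_Z J_convex V prox in_Z(1)[OF t] \<gamma>_pos[OF t]]
  \<comment> \<open>The first prox step is tested at the output of the second, and the second at
    \<open>u\<close>; consequently the discrepancy between \<open>?hw\<close> and \<open>?hr\<close>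
    is multiplied only by \<open>?w - ?r'\<close>.\<close>
  have p1: "(\<gamma> t *\<^sub>R ?hr + \<gamma> t *\<^sub>R ?g + ?w - ?r) \<bullet> (?w - ?r') + \<gamma> t * (J ?w - J ?r') \<le> 0"
    using pv[OF in_Z(5)[OF t], of "\<gamma> t *\<^sub>R ?hr + \<gamma> t *\<^sub>R ?g"] unfolding run_step(2)[OF t, symmetric] .
  have p2: "(\<gamma> t *\<^sub>R ?hw + \<gamma> t *\<^sub>R ?g + ?r' - ?r) \<bullet> (?r' - u) + \<gamma> t * (J ?r' - J u) \<le> 0"
    using pv[OF u, of "\<gamma> t *\<^sub>R ?hw + \<gamma> t *\<^sub>R ?g"] unfolding run_step(3)[OF t, symmetric] .
  \<comment> \<open>Three-point identities; the squared distance from \<open>?r\<close> to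
    \<open>?r'\<close> occurs in them with opposite signs and cancels in the sum.\<close>
  have e1: "(?w - ?r) \<bullet> (?w - ?r') = (norm (?w - ?r))\<^sup>2 / 2 + (norm (?w - ?r'))\<^sup>2 / 2 - (norm (?r - ?r'))\<^sup>2 / 2"
    by (simp add: power2_norm_eq_inner inner_diff inner_commute field_simps)
  have e2: "(?r' - ?r) \<bullet> (?r' - u) = (norm (?r - ?r'))\<^sup>2 / 2 + (norm (?r' - u))\<^sup>2 / 2 - (norm (?r - u))\<^sup>2 / 2"
    by (simp add: power2_norm_eq_inner inner_diff inner_commute field_simps)
  have p12: "\<gamma> t * ((?hw + ?g) \<bullet> (?w - u)) + \<gamma> t * (J ?w - J u)
      + (norm (?w - ?r))\<^sup>2 / 2 + (norm (?w - ?r'))\<^sup>2 / 2 + (norm (?r' - u))\<^sup>2 / 2 - (norm (?r - u))\<^sup>2 / 2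
      \<le> (\<gamma> t *\<^sub>R (?hw - ?hr)) \<bullet> (?w - ?r')"
  proof -
    have "(\<gamma> t *\<^sub>R ?hr + \<gamma> t *\<^sub>R ?g + ?w - ?r) \<bullet> (?w - ?r') + (\<gamma> t *\<^sub>R ?hw + \<gamma> t *\<^sub>R ?g + ?r' - ?r) \<bullet> (?r' - u)
      = \<gamma> t * ((?hw + ?g) \<bullet> (?w - u)) - (\<gamma> t *\<^sub>R (?hw - ?hr)) \<bullet> (?w - ?r')
        + (?w - ?r) \<bullet> (?w - ?r') + (?r' - ?r) \<bullet> (?r' - u)"
      by (simp add: inner_diff inner_add algebra_simps)
    then show ?thesis using p1 p2 unfolding e1 e2 by (simp add: algebra_simps)
  qed
  \<comment> \<open>Weight 1 spends exactly the term \<open>(norm (?w - ?r'))\<^sup>2 / 2\<close>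
    available in \<open>p12\<close>.\<close>
  have "(\<gamma> t *\<^sub>R (?hw - ?hr)) \<bullet> (?w - ?r') \<le> (\<gamma> t)\<^sup>2 * (norm (?hw - ?hr))\<^sup>2 / 2 + (norm (?w - ?r'))\<^sup>2 / 2"
    using inner_le_weighted_squares[of 1 "\<gamma> t *\<^sub>R (?hw - ?hr)" "?w - ?r'"] by (simp add: power_mult_distrib)
  with p12 operator_difference[OF t]
  have A: "\<gamma> t * ((?hw + ?g) \<bullet> (?w - u)) + \<gamma> t * (J ?w - J u)
      + (norm (?w - ?r))\<^sup>2 / 2 + (norm (?r' - u))\<^sup>2 / 2
      \<le> (norm (?r - u))\<^sup>2 / 2 + 3 / 2 * L_H\<^sup>2 * (\<gamma> t)\<^sup>2 * (norm (?w - ?r))\<^sup>2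
      + 3 / 2 * (\<gamma> t)\<^sup>2 * ((norm (errH1 t))\<^sup>2 + (norm (errH2 t))\<^sup>2)"
    by (simp add: algebra_simps)
  \<comment> \<open>The error of \<open>g\<close> is moved from \<open>?w\<close>, which depends on
    the same answer, to \<open>?r\<close>, which was known before it.\<close>
  have B: "(?hw + ?g) \<bullet> (?w - u) = (gradG (wmd t) + H ?w) \<bullet> (?w - u)
      + (errH2 t \<bullet> (?w - u) + errG t \<bullet> (?r - u)) + errG t \<bullet> (?w - ?r)"
    by (simp add: errH2_def errG_def inner_diff inner_add algebra_simps)
  have "- (\<gamma> t * (errG t \<bullet> (?w - ?r))) = (- \<gamma> t *\<^sub>R errG t) \<bullet> (?w - ?r)" by simp
  also have "\<dots> \<le> (\<gamma> t)\<^sup>2 / (2 * (1 - q)) * (norm (errG t))\<^sup>2 + (1 - q) / 2 * (norm (?w - ?r))\<^sup>2"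
    using inner_le_weighted_squares[of "1 - q" "- \<gamma> t *\<^sub>R errG t" "?w - ?r"] q_less
    by (simp add: power_mult_distrib)
  finally have C: "- (\<gamma> t * (errG t \<bullet> (?w - ?r))) \<le> (\<gamma> t)\<^sup>2 / (2 * (1 - q)) * (norm (errG t))\<^sup>2
    + (1 - q) / 2 * (norm (?w - ?r))\<^sup>2" .
  have D: "S t * gap_Q G H J (wag (t + 1)) u \<le> S (t - 1) * gap_Q G H J (wag t) u
    + \<gamma> t * ((gradG (wmd t) + H ?w) \<bullet> (?w - u) + J ?w - J u) + L_G * \<alpha> t * \<gamma> t / 2 * (norm (?w - ?r))\<^sup>2"
    by (rule gap_step[OF t in_Z(2,1,4)[OF t] u run_step(1,4)[OF t]])
  have F: "(L_G * \<alpha> t * \<gamma> t + 3 * L_H\<^sup>2 * (\<gamma> t)\<^sup>2) * (norm (?w - ?r))\<^sup>2 \<le> c\<^sup>2 * (norm (?w - ?r))\<^sup>2"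
    using step[OF t] by (intro mult_right_mono) auto
  show ?thesis
    using A C D F unfolding B noise_def by (simp add: algebra_simps add_divide_distrib diff_divide_distrib)
qed

section \<open>Summation over the iterations\<close>

definition err_sum :: "nat \<Rightarrow> 'a" where
  "err_sum t = (\<Sum>i=1..t. \<gamma> i *\<^sub>R errH2 i + \<gamma> i *\<^sub>R errG i)"

text \<open>The part of the error terms with zero mean: centred at the fixed point
  \<open>us\<close>, each error meets a vector known before its sample. A comparison point
  \<open>u\<close> in the supremum may depend on the outcome, and is confined to a product with
  \<open>err_sum\<close>.\<close>

definition mart :: "nat \<Rightarrow> real" where
  "mart t = (\<Sum>i=1..t. \<gamma> i * (errH2 i \<bullet> (w (i + 1) - us) + errG i \<bullet> (r i - us)))"

text \<open>Telescoping starts from \<open>S 0 = 0\<close>, which removes the initial gap. The error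
  products are recentred from \<open>u\<close> to \<open>us\<close> at each step.\<close>

lemma summed_step:
  assumes u: "u \<in> Z"
  shows "S t * gap_Q G H J (wag (t + 1)) u + (norm (r (t + 1) - u))\<^sup>2 / 2
      + (\<Sum>i=1..t. (q - c\<^sup>2) / 2 * (norm (w (i + 1) - r i))\<^sup>2)
    \<le> (norm (r1 - u))\<^sup>2 / 2 + (\<Sum>i=1..t. noise i) - mart t + err_sum t \<bullet> (u - us)"
proof (induction t)
  case 0
  then show ?case using run1 by (simp add: mart_def err_sum_def)
next
  case (Suc t)
  have "errH2 (Suc t) \<bullet> (w (Suc t + 1) - u) + errG (Suc t) \<bullet> (r (Suc t) - u)
    = (errH2 (Suc t) \<bullet> (w (Suc t + 1) - us) + errG (Suc t) \<bullet> (r (Suc t) - us))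
      - (errH2 (Suc t) + errG (Suc t)) \<bullet> (u - us)"
    by (simp add: inner_diff inner_add)
  then show ?case
    using Suc one_step[of "Suc t" u] u
    by (simp add: mart_def err_sum_def inner_add algebra_simps)
qed

text \<open>Expanding the bound of \<open>summed_step\<close> about the aggregated point shows its
  linear part in \<open>u\<close>: the squared distances contribute the slope
  \<open>r1 - r (t + 1)\<close> and the errors contribute \<open>- err_sum t\<close>. Division by
  \<open>S t\<close> gives the perturbation.\<close>

lemma perturbed_gap_le:
  assumes t: "t \<ge> 1"
  defines "\<epsilon> \<equiv> ((norm (r1 - us))\<^sup>2 + 3 / 2 * (norm (wag (t + 1) - us))\<^sup>2 + (\<Sum>i=1..t. noise i) - mart t
      + (norm (err_sum t))\<^sup>2 / 2) / S t"
  shows "perturbed_gap Z G H J (wag (t + 1)) ((1 / S t) *\<^sub>R (r1 - r (t + 1) - err_sum t)) \<le> ereal \<epsilon>"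
    and "0 \<le> \<epsilon>"
proof -
  let ?x = "wag (t + 1)" and ?r = "r (t + 1)" and ?A = "err_sum t"
  let ?v = "(1 / S t) *\<^sub>R (r1 - ?r - ?A)"
  have main: "gap_Q G H J ?x u - ?v \<bullet> (?x - u) \<le> \<epsilon>" if u: "u \<in> Z" for u
  proof -
    have "0 \<le> (\<Sum>i=1..t. (q - c\<^sup>2) / 2 * (norm (w (i + 1) - r i))\<^sup>2)"
      using c2_less by (intro sum_nonneg) auto
    with summed_step[OF u, of t]
    have "S t * gap_Q G H J ?x u \<le> (norm (r1 - u))\<^sup>2 / 2 - (norm (?r - u))\<^sup>2 / 2
        + (\<Sum>i=1..t. noise i) - mart t + ?A \<bullet> (u - us)" by simp
    \<comment> \<open>The quadratic parts in \<open>u\<close> cancel, so the difference is affine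
      and its constant can be read off at \<open>u = ?x\<close>.\<close>
    moreover have "(norm (r1 - u))\<^sup>2 / 2 - (norm (?r - u))\<^sup>2 / 2 - (r1 - ?r) \<bullet> (?x - u)
        = (norm (r1 - ?x))\<^sup>2 / 2 - (norm (?r - ?x))\<^sup>2 / 2"
      by (simp add: power2_norm_eq_inner inner_diff inner_commute field_simps)
    moreover have "?A \<bullet> (u - us) + ?A \<bullet> (?x - u) = ?A \<bullet> (?x - us)"
      by (simp add: inner_diff)
    moreover have "?A \<bullet> (?x - us) \<le> (norm ?A)\<^sup>2 / 2 + (norm (?x - us))\<^sup>2 / 2"
      using inner_le_weighted_squares[of 1 ?A "?x - us"] by simp
    \<comment> \<open>One full square of \<open>?x - us\<close> from here and one half from the
      preceding inequality make the 3/2 in \<open>\<epsilon>\<close>; all distances now refer to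
      \<open>us\<close>.\<close>
    moreover have "(norm (r1 - ?x))\<^sup>2 / 2 \<le> (norm (r1 - us))\<^sup>2 + (norm (?x - us))\<^sup>2"
      using norm_add_squared_le[of "r1 - us" "us - ?x"] by (simp add: norm_minus_commute)
    moreover have "S t * (?v \<bullet> (?x - u)) = (r1 - ?r) \<bullet> (?x - u) - ?A \<bullet> (?x - u)"
      using S_pos[OF t] by (simp add: inner_diff algebra_simps)
    moreover have "0 \<le> (norm (?r - ?x))\<^sup>2" by simp
    moreover have "\<epsilon> * S t = (norm (r1 - us))\<^sup>2 + 3 / 2 * (norm (?x - us))\<^sup>2 + (\<Sum>i=1..t. noise i)
        - mart t + (norm ?A)\<^sup>2 / 2"
      unfolding \<epsilon>_def using S_pos[OF t] by simp
    moreover have "S t * (gap_Q G H J ?x u - ?v \<bullet> (?x - u)) = S t * gap_Q G H J ?x u - S t * (?v \<bullet> (?x - u))"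
      by (rule right_diff_distrib)
    ultimately have "S t * (gap_Q G H J ?x u - ?v \<bullet> (?x - u)) \<le> \<epsilon> * S t"
      by linarith
    then show ?thesis using S_pos[OF t] by (simp add: mult.commute)
  qed
  show "perturbed_gap Z G H J ?x ?v \<le> ereal \<epsilon>"
    unfolding perturbed_gap_def using main by (intro SUP_least) simp
  show "0 \<le> \<epsilon>" using main[OF in_Z(6)[OF t]] by (simp add: gap_Q_def)
qed

text \<open>Jensen's inequality for the squared norm and the weighted average, proved along the
  recursion.\<close>

lemma wag_dist:
  "S t * (norm (wag (t + 1) - us))\<^sup>2 \<le> (\<Sum>i=1..t. \<gamma> i * (norm (w (i + 1) - us))\<^sup>2)"
proof (induction t)
  case 0 then show ?case by simp
next
  case (Suc t)
  let ?t = "Suc t"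
  let ?a = "\<alpha> ?t" and ?x = "wag ?t - us" and ?y = "w (?t + 1) - us"
  have a: "0 \<le> ?a" "?a \<le> 1" using \<alpha>_ge[of ?t] \<alpha>_le[of ?t] by auto
  have "wag (?t + 1) - us = (1 - ?a) *\<^sub>R ?x + ?a *\<^sub>R ?y"
    using run_step(4)[of ?t] by (simp add: algebra_simps)
  moreover have "(norm ((1 - ?a) *\<^sub>R ?x + ?a *\<^sub>R ?y))\<^sup>2
      = (1 - ?a) * (norm ?x)\<^sup>2 + ?a * (norm ?y)\<^sup>2 - ?a * (1 - ?a) * (norm (?x - ?y))\<^sup>2"
    unfolding power2_norm_eq_inner
    by (simp add: inner_add inner_diff(1) inner_diff(2) inner_commute algebra_simps)
  moreover have "0 \<le> ?a * (1 - ?a) * (norm (?x - ?y))\<^sup>2" using a by simp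
  ultimately have "(norm (wag (?t + 1) - us))\<^sup>2 \<le> (1 - ?a) * (norm ?x)\<^sup>2 + ?a * (norm ?y)\<^sup>2" by simp
  then have "S ?t * (norm (wag (?t + 1) - us))\<^sup>2 \<le> S ?t * ((1 - ?a) * (norm ?x)\<^sup>2 + ?a * (norm ?y)\<^sup>2)"
    by (intro mult_left_mono S_nonneg)
  also have "\<dots> = (S ?t * (1 - ?a)) * (norm ?x)\<^sup>2 + (?a * S ?t) * (norm ?y)\<^sup>2"
    by (simp only: algebra_simps)
  also have "\<dots> = S t * (norm ?x)\<^sup>2 + \<gamma> ?t * (norm ?y)\<^sup>2"
    using S_one_minus_\<alpha>[of ?t] \<alpha>_eq[of ?t] by simp
  finally show ?case using Suc by simp
qed

text \<open>The telescoped bound controls \<open>r\<close>, so the distance of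
  \<open>w (t + 1)\<close> is measured via \<open>r (t + 1)\<close>. The displacement left on the
  right is paid for by the sum retained in \<open>r_dist\<close>.\<close>

lemma w_dist:
  assumes t: "t \<ge> 1"
  shows "(norm (w (t + 1) - us))\<^sup>2 \<le> 2 * (norm (r (t + 1) - us))\<^sup>2
    + 2 * c\<^sup>2 * (norm (w (t + 1) - r t))\<^sup>2
    + 6 * (\<gamma> t)\<^sup>2 * ((norm (errH1 t))\<^sup>2 + (norm (errH2 t))\<^sup>2)"
  using norm_add_squared_le[of "w (t + 1) - r (t + 1)" "r (t + 1) - us"] extrapolation_gap[OF t]
  by simp

lemma r_dist:
  "(norm (r (t + 1) - us))\<^sup>2 + (q - c\<^sup>2) * (\<Sum>i=1..t. (norm (w (i + 1) - r i))\<^sup>2)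
    \<le> (norm (r1 - us))\<^sup>2 + 2 * (\<Sum>i=1..t. noise i) - 2 * mart t"
proof -
  have "0 \<le> S t * gap_Q G H J (wag (t + 1)) us"
    using r_wag_in_Z[of "t + 1"] gap_us S_nonneg by simp
  moreover have "(\<Sum>i=1..t. (q - c\<^sup>2) / 2 * (norm (w (i + 1) - r i))\<^sup>2)
      = (q - c\<^sup>2) * (\<Sum>i=1..t. (norm (w (i + 1) - r i))\<^sup>2) / 2"
    by (simp add: sum_distrib_left sum_divide_distrib)
  moreover have "err_sum t \<bullet> (us - us) = 0" by simp
  ultimately show ?thesis using summed_step[OF us, of t] by linarith
qed

text \<open>The crude bound below makes every iterate square integrable. It avoids any growth
  assumption on \<open>gradG\<close>, which is unconstrained in the directions normal to the affine hull
  of \<open>Z\<close>.\<close>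

definition potential :: "nat \<Rightarrow> real" where
  "potential t = S t * gap_Q G H J (wag (t + 1)) us + (norm (r (t + 1) - us))\<^sup>2 / 2"

lemma potential_ge: "(norm (r (t + 1) - us))\<^sup>2 \<le> 2 * potential t"
  using r_wag_in_Z[of "t + 1"] gap_us S_nonneg[of t] by (simp add: potential_def)

lemma potential_step:
  assumes t: "t \<ge> 1"
  shows "potential t + (q - c\<^sup>2) / 4 * (norm (w (t + 1) - r t))\<^sup>2
    \<le> 3 * potential (t - 1) + noise t
      + ((\<gamma> t)\<^sup>2 / (q - c\<^sup>2) + (\<gamma> t)\<^sup>2 / 2) * (norm (errH2 t))\<^sup>2 + (\<gamma> t)\<^sup>2 / 2 * (norm (errG t))\<^sup>2"
proof -
  have 1: "potential t + (q - c\<^sup>2) / 2 * (norm (w (t + 1) - r t))\<^sup>2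
    \<le> potential (t - 1) + noise t - \<gamma> t * (errH2 t \<bullet> (w (t + 1) - us) + errG t \<bullet> (r t - us))"
    using one_step[OF t us] t by (simp add: potential_def)
  have 2: "(norm (r t - us))\<^sup>2 \<le> 2 * potential (t - 1)"
    using potential_ge[of "t - 1"] t by simp
  have 3: "- \<gamma> t * (errH2 t \<bullet> (w (t + 1) - us) + errG t \<bullet> (r t - us))
     = (- \<gamma> t *\<^sub>R errH2 t) \<bullet> (w (t + 1) - r t) + (- \<gamma> t *\<^sub>R errH2 t) \<bullet> (r t - us) + (- \<gamma> t *\<^sub>R errG t) \<bullet> (r t - us)"
    by (simp add: inner_diff algebra_simps)
  \<comment> \<open>Young's inequality with weight \<open>(q - c\<^sup>2) / 2\<close> spends half of
    the surviving displacement term and leaves the quarter claimed.\<close>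
  have 4: "(- \<gamma> t *\<^sub>R errH2 t) \<bullet> (w (t + 1) - r t)
      \<le> (\<gamma> t)\<^sup>2 / (q - c\<^sup>2) * (norm (errH2 t))\<^sup>2 + (q - c\<^sup>2) / 4 * (norm (w (t + 1) - r t))\<^sup>2"
  proof -
    have "2 * ((q - c\<^sup>2) / 2) = q - c\<^sup>2" "(q - c\<^sup>2) / 2 / 2 = (q - c\<^sup>2) / 4" by simp_all
    then show ?thesis
      using inner_le_weighted_squares[of "(q - c\<^sup>2) / 2" "- \<gamma> t *\<^sub>R errH2 t" "w (t + 1) - r t"] c2_less
      by (simp only: norm_scaleR power_mult_distrib) simp
  qed
  have 5: "(- \<gamma> t *\<^sub>R errH2 t) \<bullet> (r t - us) \<le> (\<gamma> t)\<^sup>2 / 2 * (norm (errH2 t))\<^sup>2 + (norm (r t - us))\<^sup>2 / 2"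
    using inner_le_weighted_squares[of 1 "- \<gamma> t *\<^sub>R errH2 t" "r t - us"] by (simp add: power_mult_distrib)
  have 6: "(- \<gamma> t *\<^sub>R errG t) \<bullet> (r t - us) \<le> (\<gamma> t)\<^sup>2 / 2 * (norm (errG t))\<^sup>2 + (norm (r t - us))\<^sup>2 / 2"
    using inner_le_weighted_squares[of 1 "- \<gamma> t *\<^sub>R errG t" "r t - us"] by (simp add: power_mult_distrib)
  \<comment> \<open>The factor 3 counts the old potential plus the two halves of the squared
    distance of \<open>r t\<close> from \<open>5\<close> and \<open>6\<close>, each bounded by the
    old potential through \<open>2\<close>.\<close>
  show ?thesis using 1 2 3 4 5 6 by (simp add: algebra_simps)
qed

end

section \<open>Samples and their history\<close>

text \<open>\<^const>\<open>prob_space.indep_var\<close> requires both random variables to have the same value type.\<close>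

lemma (in prob_space) distr_pair_eq_indep_set:
  assumes indep: "indep_set A B"
    and f[measurable]: "f \<in> measurable M N" and g[measurable]: "g \<in> measurable M L"
    and fA: "\<And>E. E \<in> sets N \<Longrightarrow> f -` E \<inter> space M \<in> A"
    and gB: "\<And>E. E \<in> sets L \<Longrightarrow> g -` E \<inter> space M \<in> B"
  shows "distr M N f \<Otimes>\<^sub>M distr M L g = distr M (N \<Otimes>\<^sub>M L) (\<lambda>\<omega>. (f \<omega>, g \<omega>))"
proof (rule pair_measure_eqI)
  interpret f: prob_space "distr M N f" by (rule prob_space_distr) simp
  interpret g: prob_space "distr M L g" by (rule prob_space_distr) simp
  show "sigma_finite_measure (distr M N f)" "sigma_finite_measure (distr M L g)" by unfold_locales
  show "sets (distr M N f \<Otimes>\<^sub>M distr M L g) = sets (distr M (N \<Otimes>\<^sub>M L) (\<lambda>\<omega>. (f \<omega>, g \<omega>)))"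
    by (simp cong: sets_pair_measure_cong)
  fix E F assume "E \<in> sets (distr M N f)" "F \<in> sets (distr M L g)"
  then have E[measurable]: "E \<in> sets N" and F[measurable]: "F \<in> sets L" by auto
  have "prob ((f -` E \<inter> space M) \<inter> (g -` F \<inter> space M)) = prob (f -` E \<inter> space M) * prob (g -` F \<inter> space M)"
    by (rule indep_setD[OF indep fA[OF E] gB[OF F]])
  moreover have "(\<lambda>\<omega>. (f \<omega>, g \<omega>)) -` (E \<times> F) \<inter> space M = (f -` E \<inter> space M) \<inter> (g -` F \<inter> space M)"
    by auto
  ultimately show "emeasure (distr M N f) E * emeasure (distr M L g) F
      = emeasure (distr M (N \<Otimes>\<^sub>M L) (\<lambda>\<omega>. (f \<omega>, g \<omega>))) (E \<times> F)"
    by (simp add: emeasure_distr emeasure_eq_measure ennreal_mult)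
qed

locale oracle_samples = prob_space M
  for M :: "'w measure" and X :: "'x measure" and Y :: "'y measure"
    and \<xi> :: "nat \<Rightarrow> 'w \<Rightarrow> 'x" and \<zeta> :: "nat \<Rightarrow> 'w \<Rightarrow> 'y" +
  assumes jointly_indep: "jointly_indep M X \<xi> Y \<zeta>"
begin

definition gen :: "nat + nat \<Rightarrow> 'w set set" where
  "gen = case_sum (\<lambda>i. {\<xi> i -` A \<inter> space M | A. A \<in> sets X}) (\<lambda>i. {\<zeta> i -` A \<inter> space M | A. A \<in> sets Y})"

text \<open>The history after \<open>a\<close> calls of the first oracle and \<open>b\<close> calls
  of the second. Two counters are kept because an iteration makes one call of the former and two of
  the latter, interleaved with the prox steps.\<close>

definition past :: "nat \<Rightarrow> nat \<Rightarrow> 'w measure" where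
  "past a b = sigma (space M) (\<Union>k\<in>{1..a} <+> {1..b}. gen k)"

lemma rv: "i \<ge> 1 \<Longrightarrow> \<xi> i \<in> measurable M X" "i \<ge> 1 \<Longrightarrow> \<zeta> i \<in> measurable M Y"
  using jointly_indep by (auto simp: jointly_indep_def)

lemma gen_Pow: "gen k \<subseteq> Pow (space M)"
  by (cases k) (auto simp: gen_def)

lemma space_past [simp]: "space (past a b) = space M"
  unfolding past_def using gen_Pow by (intro space_measure_of) blast

lemma sets_past: "sets (past a b) = sigma_sets (space M) (\<Union>k\<in>{1..a} <+> {1..b}. gen k)"
  unfolding past_def using gen_Pow by (intro sets_measure_of) blast

lemma past_mono: "a \<le> a' \<Longrightarrow> b \<le> b' \<Longrightarrow> subalgebra (past a' b') (past a b)"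
proof -
  assume "a \<le> a'" "b \<le> b'"
  then have "{1..a} <+> {1..b} \<subseteq> {1..a'} <+> {1..b'}" by auto
  then show ?thesis
    unfolding subalgebra_def sets_past by (intro conjI sigma_sets_mono' UN_mono) auto
qed

lemma gen_events: assumes "k \<in> {1..} <+> {1..}" shows "gen k \<subseteq> events"
proof (cases k)
  case (Inl i)
  with assms have "i \<ge> 1" by auto
  with rv(1)[of i] Inl show ?thesis by (auto simp: gen_def intro: measurable_sets)
next
  case (Inr i)
  with assms have "i \<ge> 1" by auto
  with rv(2)[of i] Inr show ?thesis by (auto simp: gen_def intro: measurable_sets)
qed

lemma past_subalgebra: "subalgebra M (past a b)"
proof -
  have "(\<Union>k\<in>{1..a} <+> {1..b}. gen k) \<subseteq> events"
    by (intro UN_least gen_events) auto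
  then show ?thesis
    unfolding subalgebra_def sets_past by (auto dest: sets.sigma_sets_subset)
qed

lemma measurable_past: "f \<in> measurable (past a b) N \<Longrightarrow> f \<in> measurable M N"
  using past_subalgebra by (rule measurable_from_subalg)

lemma measurable_past_mono:
  "f \<in> measurable (past a b) N \<Longrightarrow> a \<le> a' \<Longrightarrow> b \<le> b' \<Longrightarrow> f \<in> measurable (past a' b') N"
  using past_mono by (rule measurable_from_subalg)

lemma sample_past:
  "1 \<le> i \<Longrightarrow> i \<le> a \<Longrightarrow> \<xi> i \<in> measurable (past a b) X"
  "1 \<le> i \<Longrightarrow> i \<le> b \<Longrightarrow> \<zeta> i \<in> measurable (past a b) Y"
proof -
  show "\<xi> i \<in> measurable (past a b) X" if "1 \<le> i" "i \<le> a"
  proof (rule measurableI)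
    fix A assume "A \<in> sets X"
    then have "\<xi> i -` A \<inter> space M \<in> gen (Inl i)" by (auto simp: gen_def)
    then show "\<xi> i -` A \<inter> space (past a b) \<in> sets (past a b)"
      using that unfolding sets_past space_past by (intro sigma_sets.Basic) auto
  qed (use measurable_space[OF rv(1)[OF that(1)]] in simp)
  show "\<zeta> i \<in> measurable (past a b) Y" if "1 \<le> i" "i \<le> b"
  proof (rule measurableI)
    fix A assume "A \<in> sets Y"
    then have "\<zeta> i -` A \<inter> space M \<in> gen (Inr i)" by (auto simp: gen_def)
    then show "\<zeta> i -` A \<inter> space (past a b) \<in> sets (past a b)"
      using that unfolding sets_past space_past by (intro sigma_sets.Basic) auto
  qed (use measurable_space[OF rv(2)[OF that(1)]] in simp)
qed

lemma Int_stable_gen: "Int_stable (gen k)"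
proof (cases k)
  case (Inl i)
  show ?thesis unfolding Int_stable_def
  proof (intro ballI)
    fix A B assume "A \<in> gen k" "B \<in> gen k"
    then obtain A' B' where "A = \<xi> i -` A' \<inter> space M" "B = \<xi> i -` B' \<inter> space M" "A' \<in> sets X" "B' \<in> sets X"
      by (auto simp: gen_def Inl)
    then show "A \<inter> B \<in> gen k" by (auto simp: gen_def Inl intro!: exI[of _ "A' \<inter> B'"])
  qed
next
  case (Inr i)
  show ?thesis unfolding Int_stable_def
  proof (intro ballI)
    fix A B assume "A \<in> gen k" "B \<in> gen k"
    then obtain A' B' where "A = \<zeta> i -` A' \<inter> space M" "B = \<zeta> i -` B' \<inter> space M" "A' \<in> sets Y" "B' \<in> sets Y"
      by (auto simp: gen_def Inr)
    then show "A \<inter> B \<in> gen k" by (auto simp: gen_def Inr intro!: exI[of _ "A' \<inter> B'"])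
  qed
qed

text \<open>History and new sample are generated by disjoint blocks of one independent family of
  intersection-stable systems, so independence passes to the generated sigma-algebras.\<close>

lemma indep_set_past:
  assumes k: "k \<in> {1..} <+> {1..}" "k \<notin> {1..a} <+> {1..b}"
  shows "indep_set (sets (past a b)) (sigma_sets (space M) (gen k))"
proof -
  let ?I = "\<lambda>j. if j then {1..a} <+> {1..b} else {k}"
  have all: "indep_sets gen ({1..} <+> {1..})"
    using jointly_indep by (simp add: jointly_indep_def gen_def)
  have "indep_sets (\<lambda>j. sigma_sets (space M) (\<Union>i\<in>?I j. gen i)) UNIV"
  proof (rule indep_sets_collect_sigma)
    show "indep_sets gen (\<Union>j\<in>UNIV. ?I j)"
    proof (rule indep_sets_mono_index[OF _ all])
      show "(\<Union>j\<in>UNIV. ?I j) \<subseteq> {1..} <+> {1..}"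
        using k(1) by (auto simp: UNIV_bool)
    qed
    show "disjoint_family_on ?I UNIV"
      using k(2) by (simp add: disjoint_family_on_def UNIV_bool)
  qed (rule Int_stable_gen)
  moreover have "(\<lambda>j. sigma_sets (space M) (\<Union>i\<in>?I j. gen i))
      = case_bool (sets (past a b)) (sigma_sets (space M) (gen k))"
    by (auto simp: sets_past fun_eq_iff split: bool.split)
  ultimately show ?thesis by (simp add: indep_set_def)
qed

text \<open>Independence as a product law, the form needed for Fubini; \<open>f\<close> will be the
  pair of query point and weight vector.\<close>

lemma distr_past_next:
  assumes f: "f \<in> measurable (past a b) N"
  shows "a < i \<Longrightarrow> distr M N f \<Otimes>\<^sub>M distr M X (\<xi> i) = distr M (N \<Otimes>\<^sub>M X) (\<lambda>\<omega>. (f \<omega>, \<xi> i \<omega>))"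
    and "b < i \<Longrightarrow> distr M N f \<Otimes>\<^sub>M distr M Y (\<zeta> i) = distr M (N \<Otimes>\<^sub>M Y) (\<lambda>\<omega>. (f \<omega>, \<zeta> i \<omega>))"
proof -
  have pre: "f -` A \<inter> space M \<in> sets (past a b)" if "A \<in> sets N" for A
    using measurable_sets[OF f that] by simp
  show "distr M N f \<Otimes>\<^sub>M distr M X (\<xi> i) = distr M (N \<Otimes>\<^sub>M X) (\<lambda>\<omega>. (f \<omega>, \<xi> i \<omega>))" if "a < i"
    using that
    by (intro distr_pair_eq_indep_set[OF indep_set_past[of "Inl i" a b]] measurable_past[OF f] rv pre)
      (auto simp: gen_def)
  show "distr M N f \<Otimes>\<^sub>M distr M Y (\<zeta> i) = distr M (N \<Otimes>\<^sub>M Y) (\<lambda>\<omega>. (f \<omega>, \<zeta> i \<omega>))" if "b < i"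
    using that
    by (intro distr_pair_eq_indep_set[OF indep_set_past[of "Inr i" a b]] measurable_past[OF f] rv pre)
      (auto simp: gen_def)
qed

end

lemma measurable_oracle_answer:
  assumes "(\<lambda>(x, s). Q x s) \<in> borel_measurable (restrict_space borel Z \<Otimes>\<^sub>M Y)"
    and "x \<in> borel_measurable N" "\<And>\<omega>. \<omega> \<in> space N \<Longrightarrow> x \<omega> \<in> Z" "s \<in> measurable N Y"
  shows "(\<lambda>\<omega>. Q (x \<omega>) (s \<omega>)) \<in> borel_measurable N"
proof -
  have "x \<in> measurable N (restrict_space borel Z)"
    using assms(2,3) by (intro measurable_restrict_space2) auto
  then have "(\<lambda>\<omega>. (x \<omega>, s \<omega>)) \<in> measurable N (restrict_space borel Z \<Otimes>\<^sub>M Y)"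
    using assms(4) by measurable
  from measurable_compose[OF this assms(1)] show ?thesis by simp
qed

lemma measurable_continuous_on_compose:
  assumes "continuous_on Z F" "x \<in> borel_measurable N" "\<And>\<omega>. \<omega> \<in> space N \<Longrightarrow> x \<omega> \<in> Z"
  shows "(\<lambda>\<omega>. F (x \<omega>)) \<in> borel_measurable N"
proof -
  have "x \<in> measurable N (restrict_space borel Z)"
    using assms(2,3) by (intro measurable_restrict_space2) auto
  from measurable_compose[OF this borel_measurable_continuous_on_restrict[OF assms(1)]]
  show ?thesis .
qed

lemma abs_inner_le_squares: "\<bar>x \<bullet> y\<bar> \<le> (norm x)\<^sup>2 + (norm (y :: 'a::real_inner))\<^sup>2"
proof -
  have "\<bar>x \<bullet> y\<bar> \<le> norm x * norm y" by (rule Cauchy_Schwarz_ineq2)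
  also have "\<dots> \<le> (norm x)\<^sup>2 + (norm y)\<^sup>2"
    using sum_squares_bound[of "norm x" "norm y"] mult_nonneg_nonneg[OF norm_ge_zero[of x] norm_ge_zero[of y]]
    by linarith
  finally show ?thesis .
qed

text \<open>By independence, the answer at a random point can be integrated over the sample first,
  with the query point and the weight \<open>y\<close> frozen.\<close>

lemma (in prob_space) oracle_at_independent_point:
  fixes Q :: "'b::euclidean_space \<Rightarrow> 's \<Rightarrow> 'b"
  assumes xy: "(\<lambda>\<omega>. (x \<omega>, y \<omega>)) \<in> measurable M (restrict_space borel Z \<Otimes>\<^sub>M borel)"
    and s[measurable]: "s \<in> measurable M N"
    and indep: "distr M (restrict_space borel Z \<Otimes>\<^sub>M borel) (\<lambda>\<omega>. (x \<omega>, y \<omega>)) \<Otimes>\<^sub>M distr M N s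
      = distr M ((restrict_space borel Z \<Otimes>\<^sub>M borel) \<Otimes>\<^sub>M N) (\<lambda>\<omega>. ((x \<omega>, y \<omega>), s \<omega>))"
    and Q: "(\<lambda>(x, s). Q x s) \<in> borel_measurable (restrict_space borel Z \<Otimes>\<^sub>M N)"
    and F: "continuous_on Z F"
    and mean: "\<And>z. z \<in> Z \<Longrightarrow> integrable M (\<lambda>\<omega>. Q z (s \<omega>))"
      "\<And>z. z \<in> Z \<Longrightarrow> (\<integral>\<omega>. Q z (s \<omega>) \<partial>M) = F z"
    and var: "\<And>z. z \<in> Z \<Longrightarrow> integrable M (\<lambda>\<omega>. (norm (Q z (s \<omega>) - F z))\<^sup>2)"
      "\<And>z. z \<in> Z \<Longrightarrow> (\<integral>\<omega>. (norm (Q z (s \<omega>) - F z))\<^sup>2 \<partial>M) \<le> \<sigma>\<^sup>2"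
    and y: "integrable M (\<lambda>\<omega>. (norm (y \<omega>))\<^sup>2)"
  shows "integrable M (\<lambda>\<omega>. (norm (Q (x \<omega>) (s \<omega>) - F (x \<omega>)))\<^sup>2)"
    and "(\<integral>\<omega>. (norm (Q (x \<omega>) (s \<omega>) - F (x \<omega>)))\<^sup>2 \<partial>M) \<le> \<sigma>\<^sup>2"
    and "integrable M (\<lambda>\<omega>. (Q (x \<omega>) (s \<omega>) - F (x \<omega>)) \<bullet> y \<omega>)"
    and "(\<integral>\<omega>. (Q (x \<omega>) (s \<omega>) - F (x \<omega>)) \<bullet> y \<omega> \<partial>M) = 0"
proof -
  define S where "S = restrict_space borel Z \<Otimes>\<^sub>M (borel :: 'b measure)"
  have spS: "space S = Z \<times> UNIV" by (simp add: S_def space_pair_measure space_restrict_space)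
  have [measurable]: "(\<lambda>\<omega>. (x \<omega>, y \<omega>)) \<in> measurable M S"
    and prod: "distr M S (\<lambda>\<omega>. (x \<omega>, y \<omega>)) \<Otimes>\<^sub>M distr M N s = distr M (S \<Otimes>\<^sub>M N) (\<lambda>\<omega>. ((x \<omega>, y \<omega>), s \<omega>))"
    using xy indep unfolding S_def by auto
  define P where "P = distr M S (\<lambda>\<omega>. (x \<omega>, y \<omega>))"
  define T where "T = distr M N s"
  interpret P: prob_space P unfolding P_def by (rule prob_space_distr) simp
  interpret T: prob_space T unfolding T_def by (rule prob_space_distr) simp
  interpret PT: pair_sigma_finite P T ..
  have sets: "sets (P \<Otimes>\<^sub>M T) = sets (S \<Otimes>\<^sub>M N)"
    by (simp add: P_def T_def cong: sets_pair_measure_cong)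
  have PT: "P \<Otimes>\<^sub>M T = distr M (S \<Otimes>\<^sub>M N) (\<lambda>\<omega>. ((x \<omega>, y \<omega>), s \<omega>))"
    using prod by (simp add: P_def T_def)
  define f where "f p = Q (fst (fst p)) (snd p) - F (fst (fst p))" for p :: "('b \<times> 'b) \<times> 's"
  have fst: "(\<lambda>p. fst (fst p)) \<in> measurable (S \<Otimes>\<^sub>M N) borel"
    unfolding S_def by (rule measurable_compose[OF measurable_fst[THEN measurable_compose, OF measurable_fst]])
      (simp add: measurable_restrict_space1)
  have inZ: "fst (fst p) \<in> Z" if "p \<in> space (S \<Otimes>\<^sub>M N)" for p
    using that by (auto simp: space_pair_measure spS)
  have f[measurable]: "f \<in> borel_measurable (S \<Otimes>\<^sub>M N)"
    unfolding f_def
    by (intro borel_measurable_diff measurable_oracle_answer[OF Q] measurable_continuous_on_compose[OF F]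
        fst inZ measurable_snd) auto
  have slice: "(\<lambda>t. f (z, t)) \<in> borel_measurable N" if "z \<in> space S" for z
    using measurable_compose[OF measurable_Pair1'[OF that] f] .
  have snd[measurable]: "(\<lambda>p. snd (fst p)) \<in> borel_measurable (S \<Otimes>\<^sub>M N)"
    unfolding S_def by measurable
  have f_eq: "f ((x \<omega>, y \<omega>), s \<omega>) = Q (x \<omega>) (s \<omega>) - F (x \<omega>)" for \<omega>
    by (simp add: f_def)
  have pair[measurable]: "(\<lambda>\<omega>. ((x \<omega>, y \<omega>), s \<omega>)) \<in> measurable M (S \<Otimes>\<^sub>M N)" by measurable
  \<comment> \<open>Tonelli comes first: the nonnegative integral needs no prior integrability, and
    its finiteness is what makes the squared error integrable.\<close>
  have nn: "(\<integral>\<^sup>+\<omega>. ennreal ((norm (f ((x \<omega>, y \<omega>), s \<omega>)))\<^sup>2) \<partial>M) \<le> ennreal (\<sigma>\<^sup>2)"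
  proof -
    have "(\<integral>\<^sup>+\<omega>. ennreal ((norm (f ((x \<omega>, y \<omega>), s \<omega>)))\<^sup>2) \<partial>M)
        = (\<integral>\<^sup>+p. ennreal ((norm (f p))\<^sup>2) \<partial>(P \<Otimes>\<^sub>M T))"
      unfolding PT by (subst nn_integral_distr) auto
    also have "\<dots> = (\<integral>\<^sup>+z. \<integral>\<^sup>+t. ennreal ((norm (f (z, t)))\<^sup>2) \<partial>T \<partial>P)"
      by (rule T.nn_integral_fst[symmetric]) (simp add: measurable_cong_sets[OF sets refl])
    also have "\<dots> \<le> (\<integral>\<^sup>+z. ennreal (\<sigma>\<^sup>2) \<partial>P)"
    proof (rule nn_integral_mono)
      fix z assume "z \<in> space P"
      then have z: "z \<in> space S" "fst z \<in> Z" by (auto simp: P_def spS)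
      have "(\<integral>\<^sup>+t. ennreal ((norm (f (z, t)))\<^sup>2) \<partial>T) = (\<integral>\<^sup>+\<omega>. ennreal ((norm (f (z, s \<omega>)))\<^sup>2) \<partial>M)"
        unfolding T_def using slice[OF z(1)] by (subst nn_integral_distr) auto
      also have "\<dots> = ennreal (\<integral>\<omega>. (norm (f (z, s \<omega>)))\<^sup>2 \<partial>M)"
        using var(1)[OF z(2)] by (intro nn_integral_eq_integral) (auto simp: f_def)
      also have "\<dots> \<le> ennreal (\<sigma>\<^sup>2)"
        using var(2)[OF z(2)] by (intro ennreal_leI) (auto simp: f_def)
      finally show "(\<integral>\<^sup>+t. ennreal ((norm (f (z, t)))\<^sup>2) \<partial>T) \<le> ennreal (\<sigma>\<^sup>2)" .
    qed
    also have "\<dots> = ennreal (\<sigma>\<^sup>2)" by (simp add: P.emeasure_space_1)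
    finally show ?thesis .
  qed
  have fm: "(\<lambda>\<omega>. f ((x \<omega>, y \<omega>), s \<omega>)) \<in> borel_measurable M" by measurable
  have int: "integrable M (\<lambda>\<omega>. (norm (f ((x \<omega>, y \<omega>), s \<omega>)))\<^sup>2)"
    using fm le_less_trans[OF nn ennreal_less_top] by (intro integrableI_bounded) simp_all
  show "integrable M (\<lambda>\<omega>. (norm (Q (x \<omega>) (s \<omega>) - F (x \<omega>)))\<^sup>2)" using int unfolding f_eq .
  have "ennreal (\<integral>\<omega>. (norm (f ((x \<omega>, y \<omega>), s \<omega>)))\<^sup>2 \<partial>M) \<le> ennreal (\<sigma>\<^sup>2)"
    using nn by (subst nn_integral_eq_integral[symmetric]) (use int in auto)
  then show "(\<integral>\<omega>. (norm (Q (x \<omega>) (s \<omega>) - F (x \<omega>)))\<^sup>2 \<partial>M) \<le> \<sigma>\<^sup>2"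
    unfolding f_eq by simp
  have ym: "(\<lambda>\<omega>. snd (fst ((x \<omega>, y \<omega>), s \<omega>))) \<in> borel_measurable M"
    by (rule measurable_compose[OF pair snd])
  have int2: "integrable M (\<lambda>\<omega>. f ((x \<omega>, y \<omega>), s \<omega>) \<bullet> y \<omega>)"
  proof (rule Bochner_Integration.integrable_bound)
    show "integrable M (\<lambda>\<omega>. (norm (f ((x \<omega>, y \<omega>), s \<omega>)))\<^sup>2 + (norm (y \<omega>))\<^sup>2)"
      using int y by simp
    show "(\<lambda>\<omega>. f ((x \<omega>, y \<omega>), s \<omega>) \<bullet> y \<omega>) \<in> borel_measurable M"
      using fm ym by simp
  qed (use abs_inner_le_squares in auto)
  then show "integrable M (\<lambda>\<omega>. (Q (x \<omega>) (s \<omega>) - F (x \<omega>)) \<bullet> y \<omega>)" unfolding f_eq .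
  have gm: "(\<lambda>p. f p \<bullet> snd (fst p)) \<in> borel_measurable (S \<Otimes>\<^sub>M N)" by simp
  have "(\<integral>\<omega>. f ((x \<omega>, y \<omega>), s \<omega>) \<bullet> y \<omega> \<partial>M) = (\<integral>p. f p \<bullet> snd (fst p) \<partial>(P \<Otimes>\<^sub>M T))"
    unfolding PT by (subst integral_distr[OF pair gm]) simp
  also have "\<dots> = (\<integral>z. \<integral>t. f (z, t) \<bullet> snd (fst (z, t)) \<partial>T \<partial>P)"
  proof (rule PT.integral_fst'[symmetric])
    show "integrable (P \<Otimes>\<^sub>M T) (\<lambda>p. f p \<bullet> snd (fst p))"
      unfolding PT by (subst integrable_distr_eq[OF pair gm]) (use int2 in simp)
  qed
  also have "\<dots> = (\<integral>z. 0 \<partial>P)"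
  proof (rule Bochner_Integration.integral_cong[OF refl])
    fix z assume "z \<in> space P"
    then have z: "z \<in> space S" "fst z \<in> Z" by (auto simp: P_def spS)
    have "(\<integral>t. f (z, t) \<bullet> snd z \<partial>T) = (\<integral>\<omega>. f (z, s \<omega>) \<bullet> snd z \<partial>M)"
      unfolding T_def
      by (rule integral_distr[OF s])
        (intro borel_measurable_inner borel_measurable_const slice[OF z(1)])
    also have "\<dots> = (\<integral>\<omega>. f (z, s \<omega>) \<partial>M) \<bullet> snd z"
      using mean(1)[OF z(2)] by (intro integral_inner_left) (auto simp: f_def)
    \<comment> \<open>With the query point frozen, unbiasedness applies and the inner integral
      vanishes for every \<open>z\<close>.\<close>
    also have "(\<integral>\<omega>. f (z, s \<omega>) \<partial>M) = 0"
      using mean[OF z(2)] by (simp add: f_def prob_space)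
    finally show "(\<integral>t. f (z, t) \<bullet> snd (fst (z, t)) \<partial>T) = 0" by simp
  qed
  finally show "(\<integral>\<omega>. (Q (x \<omega>) (s \<omega>) - F (x \<omega>)) \<bullet> y \<omega> \<partial>M) = 0"
    unfolding f_eq by simp
qed

section \<open>Moments of the iterates\<close>

definition square_integrable :: "'w measure \<Rightarrow> ('w \<Rightarrow> 'a::euclidean_space) \<Rightarrow> bool" where
  "square_integrable M f \<longleftrightarrow> f \<in> borel_measurable M \<and> integrable M (\<lambda>\<omega>. (norm (f \<omega>))\<^sup>2)"

lemma square_integrableD:
  assumes "square_integrable M f"
  shows "f \<in> borel_measurable M" "integrable M (\<lambda>\<omega>. (norm (f \<omega>))\<^sup>2)"
  using assms by (auto simp: square_integrable_def)

lemma square_integrable_bound: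
  assumes "f \<in> borel_measurable M" "integrable M g" "\<And>\<omega>. \<omega> \<in> space M \<Longrightarrow> (norm (f \<omega>))\<^sup>2 \<le> g \<omega>"
  shows "square_integrable M f"
proof -
  have "integrable M (\<lambda>\<omega>. (norm (f \<omega>))\<^sup>2)"
    by (rule Bochner_Integration.integrable_bound[OF assms(2)])
      (use assms(1,3) in \<open>auto intro!: AE_I2 intro: order_trans[OF _ abs_ge_self]\<close>)
  then show ?thesis using assms(1) by (simp add: square_integrable_def)
qed

lemma square_integrable_add:
  assumes "square_integrable M f" "square_integrable M g"
  shows "square_integrable M (\<lambda>\<omega>. f \<omega> + g \<omega>)"
proof (rule square_integrable_bound)
  show "integrable M (\<lambda>\<omega>. 2 * ((norm (f \<omega>))\<^sup>2 + (norm (g \<omega>))\<^sup>2))"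
    using assms by (simp add: square_integrable_def)
qed (use assms norm_add_squared_le in \<open>auto simp: square_integrable_def\<close>)

lemma square_integrable_scaleR:
  "square_integrable M f \<Longrightarrow> square_integrable M (\<lambda>\<omega>. a *\<^sub>R f \<omega>)"
  by (auto simp: square_integrable_def power_mult_distrib)

lemma (in prob_space) expectation_le_sqrt:
  fixes f :: "'a \<Rightarrow> real"
  assumes "f \<in> borel_measurable M" "integrable M (\<lambda>\<omega>. (f \<omega>)\<^sup>2)"
  shows "integrable M f" "expectation f \<le> sqrt (expectation (\<lambda>\<omega>. (f \<omega>)\<^sup>2))"
proof -
  show int: "integrable M f" using square_integrable_imp_integrable[OF assms] .
  have "0 \<le> variance f" by (rule integral_nonneg_AE) simp
  then have "(expectation f)\<^sup>2 \<le> expectation (\<lambda>\<omega>. (f \<omega>)\<^sup>2)"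
    using variance_eq[OF int assms(2)] by simp
  then show "expectation f \<le> sqrt (expectation (\<lambda>\<omega>. (f \<omega>)\<^sup>2))" by (rule real_le_rsqrt)
qed

lemma (in amp_problem) H_continuous: "continuous_on Z H"
proof (rule lipschitz_on_continuous_on)
  show "\<bar>L_H\<bar>-lipschitz_on Z H"
  proof (rule lipschitz_onI)
    fix x y assume "x \<in> Z" "y \<in> Z"
    then have "norm (H x - H y) \<le> L_H * norm (x - y)" by (rule H_Lipschitz)
    also have "\<dots> \<le> \<bar>L_H\<bar> * norm (x - y)" by (intro mult_right_mono) auto
    finally show "dist (H x) (H y) \<le> \<bar>L_H\<bar> * dist x y" by (simp add: dist_norm)
  qed simp
qed

section \<open>The random iterates and their adaptedness to the history\<close>

locale stochastic_amp = amp_problem Z G J gradG H L_G L_H V \<alpha> \<gamma> c q us + oracle_samples M X Y \<xi> \<zeta>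
  for Z :: "'a::euclidean_space set" and G J gradG H L_G L_H V \<alpha> \<gamma> c q us
    and M :: "'w measure" and X :: "'x measure" and Y :: "'y measure"
    and \<xi> :: "nat \<Rightarrow> 'w \<Rightarrow> 'x" and \<zeta> :: "nat \<Rightarrow> 'w \<Rightarrow> 'y" +
  fixes \<G> :: "'a \<Rightarrow> 'x \<Rightarrow> 'a" and \<H> :: "'a \<Rightarrow> 'y \<Rightarrow> 'a" and \<sigma>_G \<sigma>_H :: real
    and r1 :: 'a and r w wmd wag :: "nat \<Rightarrow> 'w \<Rightarrow> 'a"
  assumes gradG_continuous: "continuous_on Z gradG"
    and r1: "r1 \<in> Z"
    and oracle_G: "unbiased_oracle M X \<xi> Z \<G> gradG"
    and oracle_H: "unbiased_oracle M Y \<zeta> Z \<H> H"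
    and variance_G: "bounded_variance M \<xi> Z \<G> gradG \<sigma>_G"
    and variance_H: "bounded_variance M \<zeta> Z \<H> H \<sigma>_H"
    and AMP: "\<And>\<omega>. \<omega> \<in> space M \<Longrightarrow> amp_run Z V J \<alpha> \<gamma> r1
                (\<lambda>t x. \<G> x (\<xi> t \<omega>)) (\<lambda>i x. \<H> x (\<zeta> i \<omega>))
                (\<lambda>t. r t \<omega>) (\<lambda>t. w t \<omega>) (\<lambda>t. wmd t \<omega>) (\<lambda>t. wag t \<omega>)"
begin

text \<open>The errors of \<open>amp_path\<close>, and below them the quantities built from these,
  are restated as functions of the outcome: \<open>amp_path\<close> speaks of one fixed outcome,
  which does not allow integration.\<close>

definition dG :: "nat \<Rightarrow> 'w \<Rightarrow> 'a" where "dG t \<omega> = \<G> (wmd t \<omega>) (\<xi> t \<omega>) - gradG (wmd t \<omega>)"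
definition dH1 :: "nat \<Rightarrow> 'w \<Rightarrow> 'a" where "dH1 t \<omega> = \<H> (r t \<omega>) (\<zeta> (2 * t - 1) \<omega>) - H (r t \<omega>)"
definition dH2 :: "nat \<Rightarrow> 'w \<Rightarrow> 'a" where "dH2 t \<omega> = \<H> (w (t + 1) \<omega>) (\<zeta> (2 * t) \<omega>) - H (w (t + 1) \<omega>)"

definition noise :: "nat \<Rightarrow> 'w \<Rightarrow> real" where
  "noise t \<omega> = 3 / 2 * (\<gamma> t)\<^sup>2 * ((norm (dH1 t \<omega>))\<^sup>2 + (norm (dH2 t \<omega>))\<^sup>2)
     + (\<gamma> t)\<^sup>2 / (2 * (1 - q)) * (norm (dG t \<omega>))\<^sup>2"

definition err_sum :: "nat \<Rightarrow> 'w \<Rightarrow> 'a" where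
  "err_sum t \<omega> = (\<Sum>i=1..t. \<gamma> i *\<^sub>R dH2 i \<omega> + \<gamma> i *\<^sub>R dG i \<omega>)"

definition mart :: "nat \<Rightarrow> 'w \<Rightarrow> real" where
  "mart t \<omega> = (\<Sum>i=1..t. \<gamma> i * (dH2 i \<omega> \<bullet> (w (i + 1) \<omega> - us) + dG i \<omega> \<bullet> (r i \<omega> - us)))"

definition potential :: "nat \<Rightarrow> 'w \<Rightarrow> real" where
  "potential t \<omega> = S t * gap_Q G H J (wag (t + 1) \<omega>) us + (norm (r (t + 1) \<omega> - us))\<^sup>2 / 2"

text \<open>Interprets \<open>amp_path\<close> at one outcome and renames its quantities, so that
  each pathwise estimate becomes a pointwise statement about random variables.\<close>

lemma pathwise:
  assumes \<omega>: "\<omega> \<in> space M"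
  shows run1: "r 1 \<omega> = r1" "wag 1 \<omega> = r1"
    and in_Z: "t \<ge> 1 \<Longrightarrow> r t \<omega> \<in> Z" "t \<ge> 1 \<Longrightarrow> wag t \<omega> \<in> Z" "t \<ge> 1 \<Longrightarrow> wmd t \<omega> \<in> Z"
      "t \<ge> 1 \<Longrightarrow> w (t + 1) \<omega> \<in> Z"
    and run_step: "t \<ge> 1 \<Longrightarrow> wmd t \<omega> = (1 - \<alpha> t) *\<^sub>R wag t \<omega> + \<alpha> t *\<^sub>R r t \<omega>" (is "PROP ?wmd")
      "t \<ge> 1 \<Longrightarrow> w (t + 1) \<omega> = prox_map Z V J (\<gamma> t) (r t \<omega>)
        (\<gamma> t *\<^sub>R \<H> (r t \<omega>) (\<zeta> (2 * t - 1) \<omega>) + \<gamma> t *\<^sub>R \<G> (wmd t \<omega>) (\<xi> t \<omega>))" (is "PROP ?w")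
      "t \<ge> 1 \<Longrightarrow> r (t + 1) \<omega> = prox_map Z V J (\<gamma> t) (r t \<omega>)
        (\<gamma> t *\<^sub>R \<H> (w (t + 1) \<omega>) (\<zeta> (2 * t) \<omega>) + \<gamma> t *\<^sub>R \<G> (wmd t \<omega>) (\<xi> t \<omega>))" (is "PROP ?r")
      "t \<ge> 1 \<Longrightarrow> wag (t + 1) \<omega> = (1 - \<alpha> t) *\<^sub>R wag t \<omega> + \<alpha> t *\<^sub>R w (t + 1) \<omega>" (is "PROP ?wag")
    and potential_0: "potential 0 \<omega> = (norm (r1 - us))\<^sup>2 / 2" (is ?pot_0)
    and potential_ge: "(norm (r (t + 1) \<omega> - us))\<^sup>2 \<le> 2 * potential t \<omega>" (is ?pot_ge)
    and potential_step: "t \<ge> 1 \<Longrightarrow> potential t \<omega> + (q - c\<^sup>2) / 4 * (norm (w (t + 1) \<omega> - r t \<omega>))\<^sup>2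
      \<le> 3 * potential (t - 1) \<omega> + noise t \<omega>
      + ((\<gamma> t)\<^sup>2 / (q - c\<^sup>2) + (\<gamma> t)\<^sup>2 / 2) * (norm (dH2 t \<omega>))\<^sup>2 + (\<gamma> t)\<^sup>2 / 2 * (norm (dG t \<omega>))\<^sup>2"
      (is "PROP ?pot_step")
    and r_dist: "(norm (r (t + 1) \<omega> - us))\<^sup>2 + (q - c\<^sup>2) * (\<Sum>i=1..t. (norm (w (i + 1) \<omega> - r i \<omega>))\<^sup>2)
      \<le> (norm (r1 - us))\<^sup>2 + 2 * (\<Sum>i=1..t. noise i \<omega>) - 2 * mart t \<omega>" (is ?r_dist)
    and w_dist: "t \<ge> 1 \<Longrightarrow> (norm (w (t + 1) \<omega> - us))\<^sup>2 \<le> 2 * (norm (r (t + 1) \<omega> - us))\<^sup>2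
      + 2 * c\<^sup>2 * (norm (w (t + 1) \<omega> - r t \<omega>))\<^sup>2
      + 6 * (\<gamma> t)\<^sup>2 * ((norm (dH1 t \<omega>))\<^sup>2 + (norm (dH2 t \<omega>))\<^sup>2)" (is "PROP ?w_dist")
    and wag_dist: "S t * (norm (wag (t + 1) \<omega> - us))\<^sup>2 \<le> (\<Sum>i=1..t. \<gamma> i * (norm (w (i + 1) \<omega> - us))\<^sup>2)"
      (is ?wag_dist)
    and perturbed_gap_le: "t \<ge> 1 \<Longrightarrow>
      perturbed_gap Z G H J (wag (t + 1) \<omega>) ((1 / S t) *\<^sub>R (r1 - r (t + 1) \<omega> - err_sum t \<omega>))
      \<le> ereal (((norm (r1 - us))\<^sup>2 + 3 / 2 * (norm (wag (t + 1) \<omega> - us))\<^sup>2 + (\<Sum>i=1..t. noise i \<omega>)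
           - mart t \<omega> + (norm (err_sum t \<omega>))\<^sup>2 / 2) / S t)" (is "PROP ?gap")
    and residual_nonneg: "t \<ge> 1 \<Longrightarrow>
      0 \<le> ((norm (r1 - us))\<^sup>2 + 3 / 2 * (norm (wag (t + 1) \<omega> - us))\<^sup>2 + (\<Sum>i=1..t. noise i \<omega>)
           - mart t \<omega> + (norm (err_sum t \<omega>))\<^sup>2 / 2) / S t" (is "PROP ?residual")
proof -
  interpret p: amp_path Z G J gradG H L_G L_H V \<alpha> \<gamma> c q us r1
    "\<lambda>t x. \<G> x (\<xi> t \<omega>)" "\<lambda>i x. \<H> x (\<zeta> i \<omega>)" "\<lambda>t. r t \<omega>" "\<lambda>t. w t \<omega>" "\<lambda>t. wmd t \<omega>" "\<lambda>t. wag t \<omega>"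
    using r1 AMP[OF \<omega>] by unfold_locales
  have err: "p.errG = (\<lambda>i. dG i \<omega>)" "p.errH1 = (\<lambda>i. dH1 i \<omega>)" "p.errH2 = (\<lambda>i. dH2 i \<omega>)"
    by (simp_all add: fun_eq_iff p.errG_def p.errH1_def p.errH2_def dG_def dH1_def dH2_def)
  have "p.noise = (\<lambda>i. noise i \<omega>)" "p.mart = (\<lambda>i. mart i \<omega>)" "p.err_sum = (\<lambda>i. err_sum i \<omega>)"
    "p.potential = (\<lambda>i. potential i \<omega>)"
    by (simp_all add: fun_eq_iff p.noise_def noise_def p.mart_def mart_def p.err_sum_def err_sum_def
        p.potential_def potential_def err)
  note e = err this
  show "r 1 \<omega> = r1" "wag 1 \<omega> = r1" using p.run1 by auto
  then show ?pot_0 by (simp add: potential_def)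
  show "t \<ge> 1 \<Longrightarrow> r t \<omega> \<in> Z" "t \<ge> 1 \<Longrightarrow> wag t \<omega> \<in> Z" "t \<ge> 1 \<Longrightarrow> wmd t \<omega> \<in> Z"
      "t \<ge> 1 \<Longrightarrow> w (t + 1) \<omega> \<in> Z" using p.in_Z by auto
  show "PROP ?wmd" "PROP ?w" "PROP ?r" "PROP ?wag" by (fact p.run_step)+
  show ?pot_ge using p.potential_ge unfolding e .
  show "PROP ?pot_step" using p.potential_step unfolding e .
  show ?r_dist using p.r_dist unfolding e .
  show "PROP ?w_dist" using p.w_dist unfolding e .
  show ?wag_dist by (fact p.wag_dist)
  show "PROP ?gap" using p.perturbed_gap_le(1) unfolding e .
  show "PROP ?residual" using p.perturbed_gap_le(2) unfolding e .
qed

lemmas oracle_measurable =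
  measurable_oracle_answer[OF conjunct1[OF oracle_G[unfolded unbiased_oracle_def]]]
  measurable_oracle_answer[OF conjunct1[OF oracle_H[unfolded unbiased_oracle_def]]]

text \<open>Iteration \<open>t\<close> starts with \<open>t - 1\<close> samples of
  \<open>\<xi>\<close> and \<open>2 * t - 2\<close> of \<open>\<zeta>\<close>. The point
  \<open>wmd t\<close> is fixed before \<open>\<xi> t\<close>; \<open>w (t + 1)\<close> uses
  \<open>\<xi> t\<close> and \<open>\<zeta> (2 * t - 1)\<close> but is fixed before
  \<open>\<zeta> (2 * t)\<close>. These counts are what makes each query independent of its
  sample.\<close>

lemma measurable_round:
  assumes t: "t \<ge> 1"
    and r: "r t \<in> borel_measurable (past (t - 1) (2 * t - 2))"
    and wag: "wag t \<in> borel_measurable (past (t - 1) (2 * t - 2))"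
  shows "wmd t \<in> borel_measurable (past (t - 1) (2 * t - 2))"
    and "w (t + 1) \<in> borel_measurable (past t (2 * t - 1))"
    and "r (t + 1) \<in> borel_measurable (past t (2 * t))"
    and "wag (t + 1) \<in> borel_measurable (past t (2 * t))"
proof -
  note prox_meas = measurable_prox_map[OF convex_Z J_convex V prox \<gamma>_pos[OF t]]
  have "(\<lambda>\<omega>. (1 - \<alpha> t) *\<^sub>R wag t \<omega> + \<alpha> t *\<^sub>R r t \<omega>) \<in> borel_measurable (past (t - 1) (2 * t - 2))"
    using r wag by simp
  \<comment> \<open>The equations of the method hold only on \<open>space M\<close>, hence the
    passage through \<open>measurable_cong\<close>.\<close>
  then show wmd: "wmd t \<in> borel_measurable (past (t - 1) (2 * t - 2))"
    by (rule measurable_cong[THEN iffD2, rotated]) (simp add: run_step(1)[OF _ t])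
  have up1: "f \<in> borel_measurable (past (t - 1) (2 * t - 2)) \<Longrightarrow> f \<in> borel_measurable (past t (2 * t - 1))"
    for f :: "'w \<Rightarrow> 'a" by (rule measurable_past_mono) auto
  have up2: "f \<in> borel_measurable (past t (2 * t - 1)) \<Longrightarrow> f \<in> borel_measurable (past t (2 * t))"
    for f :: "'w \<Rightarrow> 'a" by (rule measurable_past_mono) auto
  have g: "(\<lambda>\<omega>. \<G> (wmd t \<omega>) (\<xi> t \<omega>)) \<in> borel_measurable (past t (2 * t - 1))"
    using t in_Z(3) by (intro oracle_measurable up1[OF wmd] sample_past) auto
  have h1: "(\<lambda>\<omega>. \<H> (r t \<omega>) (\<zeta> (2 * t - 1) \<omega>)) \<in> borel_measurable (past t (2 * t - 1))"
    using t in_Z(1) by (intro oracle_measurable up1[OF r] sample_past) auto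
  have "(\<lambda>\<omega>. prox_map Z V J (\<gamma> t) (r t \<omega>)
      (\<gamma> t *\<^sub>R \<H> (r t \<omega>) (\<zeta> (2 * t - 1) \<omega>) + \<gamma> t *\<^sub>R \<G> (wmd t \<omega>) (\<xi> t \<omega>)))
      \<in> borel_measurable (past t (2 * t - 1))"
    using t in_Z(1) g h1 by (intro prox_meas up1[OF r]) auto
  then show w: "w (t + 1) \<in> borel_measurable (past t (2 * t - 1))"
    by (rule measurable_cong[THEN iffD2, rotated]) (simp only: run_step(2)[OF _ t] space_past)
  have h2: "(\<lambda>\<omega>. \<H> (w (t + 1) \<omega>) (\<zeta> (2 * t) \<omega>)) \<in> borel_measurable (past t (2 * t))"
    using t in_Z(4)[OF _ t] by (intro oracle_measurable up2[OF w] sample_past) auto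
  have "(\<lambda>\<omega>. prox_map Z V J (\<gamma> t) (r t \<omega>)
      (\<gamma> t *\<^sub>R \<H> (w (t + 1) \<omega>) (\<zeta> (2 * t) \<omega>) + \<gamma> t *\<^sub>R \<G> (wmd t \<omega>) (\<xi> t \<omega>)))
      \<in> borel_measurable (past t (2 * t))"
    using t in_Z(1) up2[OF g] h2 by (intro prox_meas up2[OF up1[OF r]]) auto
  then show "r (t + 1) \<in> borel_measurable (past t (2 * t))"
    by (rule measurable_cong[THEN iffD2, rotated]) (simp only: run_step(3)[OF _ t] space_past)
  have "(\<lambda>\<omega>. (1 - \<alpha> t) *\<^sub>R wag t \<omega> + \<alpha> t *\<^sub>R w (t + 1) \<omega>) \<in> borel_measurable (past t (2 * t))"
    using up2[OF up1[OF wag]] up2[OF w] by simp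
  then show "wag (t + 1) \<in> borel_measurable (past t (2 * t))"
    by (rule measurable_cong[THEN iffD2, rotated]) (simp only: run_step(4)[OF _ t] space_past)
qed

lemma measurable_r_wag:
  "t \<ge> 1 \<Longrightarrow> r t \<in> borel_measurable (past (t - 1) (2 * t - 2))
    \<and> wag t \<in> borel_measurable (past (t - 1) (2 * t - 2))"
proof (induction t rule: dec_induct)
  case base
  have "(\<lambda>_. r1) \<in> borel_measurable (past 0 0)" by simp
  then have "r 1 \<in> borel_measurable (past 0 0)" "wag 1 \<in> borel_measurable (past 0 0)"
    by (rule measurable_cong[THEN iffD2, rotated]; simp only: run1 space_past)+
  then show ?case by simp
next
  case (step t)
  then show ?case using measurable_round(3,4)[of t] by simp
qed

lemma measurable_iterates:
  assumes t: "t \<ge> 1"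
  shows "r t \<in> borel_measurable (past (t - 1) (2 * t - 2))"
    and "wag t \<in> borel_measurable (past (t - 1) (2 * t - 2))"
    and "wmd t \<in> borel_measurable (past (t - 1) (2 * t - 2))"
    and "w (t + 1) \<in> borel_measurable (past t (2 * t - 1))"
  using measurable_r_wag[OF t] measurable_round[OF t] by auto

lemma measurable_errors:
  assumes t: "t \<ge> 1"
  shows "dG t \<in> borel_measurable (past t (2 * t - 1))"
    and "dH1 t \<in> borel_measurable (past t (2 * t - 1))"
    and "dH2 t \<in> borel_measurable (past t (2 * t))"
proof -
  note mi = measurable_iterates[OF t]
  have wmd: "wmd t \<in> borel_measurable (past t (2 * t - 1))" and r: "r t \<in> borel_measurable (past t (2 * t - 1))"
    by (rule measurable_past_mono[OF mi(3)] measurable_past_mono[OF mi(1)]; simp)+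
  have w: "w (t + 1) \<in> borel_measurable (past t (2 * t))"
    by (rule measurable_past_mono[OF mi(4)]) auto
  show "dG t \<in> borel_measurable (past t (2 * t - 1))"
    unfolding dG_def[abs_def] using t in_Z(3)
    by (intro borel_measurable_diff oracle_measurable measurable_continuous_on_compose[OF gradG_continuous]
        wmd sample_past) auto
  show "dH1 t \<in> borel_measurable (past t (2 * t - 1))"
    unfolding dH1_def[abs_def] using t in_Z(1)
    by (intro borel_measurable_diff oracle_measurable measurable_continuous_on_compose[OF H_continuous]
        r sample_past) auto
  show "dH2 t \<in> borel_measurable (past t (2 * t))"
    unfolding dH2_def[abs_def] using t in_Z(4)[OF _ t]
    by (intro borel_measurable_diff oracle_measurable measurable_continuous_on_compose[OF H_continuous]
        w sample_past) auto
qed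

lemma measurable_err_sum: "err_sum t \<in> borel_measurable (past t (2 * t))"
  unfolding err_sum_def[abs_def]
proof (intro borel_measurable_sum borel_measurable_add borel_measurable_scaleR borel_measurable_const)
  fix i assume "i \<in> {1..t}"
  then have i: "i \<ge> 1" "i \<le> t" by auto
  show "dH2 i \<in> borel_measurable (past t (2 * t))"
    by (rule measurable_past_mono[OF measurable_errors(3)[OF i(1)]]) (use i in auto)
  show "dG i \<in> borel_measurable (past t (2 * t))"
    by (rule measurable_past_mono[OF measurable_errors(1)[OF i(1)]]) (use i in auto)
qed

lemma measurable_pair_Z:
  assumes "x \<in> borel_measurable N" "\<And>\<omega>. \<omega> \<in> space N \<Longrightarrow> x \<omega> \<in> Z" "y \<in> borel_measurable N"
  shows "(\<lambda>\<omega>. (x \<omega>, y \<omega> :: 'a)) \<in> measurable N (restrict_space borel Z \<Otimes>\<^sub>M borel)"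
  using assms by (intro measurable_Pair measurable_restrict_space2) auto

section \<open>Mean and second moments of the oracle errors\<close>

lemma oracle_G_at:
  assumes "i \<ge> 1" "z \<in> Z"
  shows "integrable M (\<lambda>\<omega>. \<G> z (\<xi> i \<omega>))" "(\<integral>\<omega>. \<G> z (\<xi> i \<omega>) \<partial>M) = gradG z"
    and "integrable M (\<lambda>\<omega>. (norm (\<G> z (\<xi> i \<omega>) - gradG z))\<^sup>2)"
    and "(\<integral>\<omega>. (norm (\<G> z (\<xi> i \<omega>) - gradG z))\<^sup>2 \<partial>M) \<le> \<sigma>_G\<^sup>2"
  using oracle_G variance_G assms by (auto simp: unbiased_oracle_def bounded_variance_def)

lemma oracle_H_at:
  assumes "i \<ge> 1" "z \<in> Z"
  shows "integrable M (\<lambda>\<omega>. \<H> z (\<zeta> i \<omega>))" "(\<integral>\<omega>. \<H> z (\<zeta> i \<omega>) \<partial>M) = H z"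
    and "integrable M (\<lambda>\<omega>. (norm (\<H> z (\<zeta> i \<omega>) - H z))\<^sup>2)"
    and "(\<integral>\<omega>. (norm (\<H> z (\<zeta> i \<omega>) - H z))\<^sup>2 \<partial>M) \<le> \<sigma>_H\<^sup>2"
  using oracle_H variance_H assms by (auto simp: unbiased_oracle_def bounded_variance_def)

text \<open>The weight \<open>y\<close> must be known when the iteration starts, before
  \<open>\<xi> t\<close>. The second-moment claims do not mention \<open>y\<close> and are later
  used with \<open>y = 0\<close>.\<close>

lemma dG_moments:
  assumes t: "t \<ge> 1" and y: "y \<in> borel_measurable (past (t - 1) (2 * t - 2))"
    and y2: "integrable M (\<lambda>\<omega>. (norm (y \<omega>))\<^sup>2)"
  shows "integrable M (\<lambda>\<omega>. (norm (dG t \<omega>))\<^sup>2)" "(\<integral>\<omega>. (norm (dG t \<omega>))\<^sup>2 \<partial>M) \<le> \<sigma>_G\<^sup>2"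
    and "integrable M (\<lambda>\<omega>. dG t \<omega> \<bullet> y \<omega>)" "(\<integral>\<omega>. dG t \<omega> \<bullet> y \<omega> \<partial>M) = 0"
proof -
  have xy: "(\<lambda>\<omega>. (wmd t \<omega>, y \<omega>)) \<in> measurable (past (t - 1) (2 * t - 2)) (restrict_space borel Z \<Otimes>\<^sub>M borel)"
    using in_Z(3) t by (intro measurable_pair_Z measurable_iterates(3) y) auto
  show "integrable M (\<lambda>\<omega>. (norm (dG t \<omega>))\<^sup>2)" "(\<integral>\<omega>. (norm (dG t \<omega>))\<^sup>2 \<partial>M) \<le> \<sigma>_G\<^sup>2"
    "integrable M (\<lambda>\<omega>. dG t \<omega> \<bullet> y \<omega>)" "(\<integral>\<omega>. dG t \<omega> \<bullet> y \<omega> \<partial>M) = 0"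
    unfolding dG_def
    using oracle_at_independent_point[OF measurable_past[OF xy] rv(1)[OF t] distr_past_next(1)[OF xy]
        conjunct1[OF oracle_G[unfolded unbiased_oracle_def]] gradG_continuous oracle_G_at[OF t] y2] t
    by simp_all
qed

lemma dH1_moments:
  assumes t: "t \<ge> 1"
  shows "integrable M (\<lambda>\<omega>. (norm (dH1 t \<omega>))\<^sup>2)" "(\<integral>\<omega>. (norm (dH1 t \<omega>))\<^sup>2 \<partial>M) \<le> \<sigma>_H\<^sup>2"
proof -
  \<comment> \<open>The error \<open>dH1\<close> enters the estimates only through its squared norm,
    so the weight is set to 0.\<close>
  have xy: "(\<lambda>\<omega>. (r t \<omega>, 0 :: 'a)) \<in> measurable (past (t - 1) (2 * t - 2)) (restrict_space borel Z \<Otimes>\<^sub>M borel)"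
    using in_Z(1) t by (intro measurable_pair_Z measurable_iterates(1)) auto
  have t': "2 * t - 1 \<ge> 1" "2 * t - 2 < 2 * t - 1" using t by auto
  show "integrable M (\<lambda>\<omega>. (norm (dH1 t \<omega>))\<^sup>2)" "(\<integral>\<omega>. (norm (dH1 t \<omega>))\<^sup>2 \<partial>M) \<le> \<sigma>_H\<^sup>2"
    unfolding dH1_def
    using oracle_at_independent_point(1,2)[OF measurable_past[OF xy] rv(2)[OF t'(1)]
        distr_past_next(2)[OF xy t'(2)]
        conjunct1[OF oracle_H[unfolded unbiased_oracle_def]] H_continuous oracle_H_at[OF t'(1)]]
    by simp_all
qed

text \<open>In contrast to \<open>dG_moments\<close>, the weight may depend on
  \<open>\<xi> t\<close> and \<open>\<zeta> (2 * t - 1)\<close>; therefore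
  \<open>w (t + 1) - us\<close> is admissible here.\<close>

lemma dH2_moments:
  assumes t: "t \<ge> 1" and y: "y \<in> borel_measurable (past t (2 * t - 1))"
    and y2: "integrable M (\<lambda>\<omega>. (norm (y \<omega>))\<^sup>2)"
  shows "integrable M (\<lambda>\<omega>. (norm (dH2 t \<omega>))\<^sup>2)" "(\<integral>\<omega>. (norm (dH2 t \<omega>))\<^sup>2 \<partial>M) \<le> \<sigma>_H\<^sup>2"
    and "integrable M (\<lambda>\<omega>. dH2 t \<omega> \<bullet> y \<omega>)" "(\<integral>\<omega>. dH2 t \<omega> \<bullet> y \<omega> \<partial>M) = 0"
proof -
  have xy: "(\<lambda>\<omega>. (w (t + 1) \<omega>, y \<omega>)) \<in> measurable (past t (2 * t - 1)) (restrict_space borel Z \<Otimes>\<^sub>M borel)"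
    using in_Z(4)[OF _ t] by (intro measurable_pair_Z measurable_iterates(4) y t) auto
  have t': "2 * t \<ge> 1" "2 * t - 1 < 2 * t" using t by auto
  show "integrable M (\<lambda>\<omega>. (norm (dH2 t \<omega>))\<^sup>2)" "(\<integral>\<omega>. (norm (dH2 t \<omega>))\<^sup>2 \<partial>M) \<le> \<sigma>_H\<^sup>2"
    "integrable M (\<lambda>\<omega>. dH2 t \<omega> \<bullet> y \<omega>)" "(\<integral>\<omega>. dH2 t \<omega> \<bullet> y \<omega> \<partial>M) = 0"
    unfolding dH2_def
    using oracle_at_independent_point[OF measurable_past[OF xy] rv(2)[OF t'(1)]
        distr_past_next(2)[OF xy t'(2)]
        conjunct1[OF oracle_H[unfolded unbiased_oracle_def]] H_continuous oracle_H_at[OF t'(1)] y2]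
    by simp_all
qed

lemma square_integrable_errors:
  assumes t: "t \<ge> 1"
  shows "square_integrable M (dG t)" "square_integrable M (dH1 t)" "square_integrable M (dH2 t)"
  using dG_moments(1)[OF t, of "\<lambda>_. 0"] dH1_moments(1)[OF t] dH2_moments(1)[OF t, of "\<lambda>_. 0"]
    measurable_errors[OF t, THEN measurable_past]
  by (auto simp: square_integrable_def)

lemma noise_expectation:
  assumes t: "t \<ge> 1"
  shows "integrable M (noise t)"
    and "(\<integral>\<omega>. noise t \<omega> \<partial>M) \<le> (\<gamma> t)\<^sup>2 * (3 * \<sigma>_H\<^sup>2 + \<sigma>_G\<^sup>2 / (2 * (1 - q)))"
proof -
  note i = square_integrable_errors[OF t, THEN square_integrableD(2)]
  show "integrable M (noise t)" unfolding noise_def[abs_def] using i by simp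
  have "(\<integral>\<omega>. noise t \<omega> \<partial>M) = 3 / 2 * (\<gamma> t)\<^sup>2 * ((\<integral>\<omega>. (norm (dH1 t \<omega>))\<^sup>2 \<partial>M) + (\<integral>\<omega>. (norm (dH2 t \<omega>))\<^sup>2 \<partial>M))
     + (\<gamma> t)\<^sup>2 / (2 * (1 - q)) * (\<integral>\<omega>. (norm (dG t \<omega>))\<^sup>2 \<partial>M)"
    unfolding noise_def using i by simp
  also have "\<dots> \<le> 3 / 2 * (\<gamma> t)\<^sup>2 * (\<sigma>_H\<^sup>2 + \<sigma>_H\<^sup>2) + (\<gamma> t)\<^sup>2 / (2 * (1 - q)) * \<sigma>_G\<^sup>2"
    using q_less dG_moments(2)[OF t, of "\<lambda>_. 0"] dH1_moments(2)[OF t] dH2_moments(2)[OF t, of "\<lambda>_. 0"]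
    by (intro add_mono mult_left_mono) auto
  also have "\<dots> = (\<gamma> t)\<^sup>2 * (3 * \<sigma>_H\<^sup>2 + \<sigma>_G\<^sup>2 / (2 * (1 - q)))" by (simp add: algebra_simps)
  finally show "(\<integral>\<omega>. noise t \<omega> \<partial>M) \<le> (\<gamma> t)\<^sup>2 * (3 * \<sigma>_H\<^sup>2 + \<sigma>_G\<^sup>2 / (2 * (1 - q)))" .
qed

text \<open>Induction with \<open>potential_step\<close>: the errors have bounded second moments
  whatever the size of the iterates. A majorant is enough, and spares the measurability of
  \<open>G\<close> and \<open>J\<close> along the iterates.\<close>

lemma potential_bound:
  "\<exists>K. integrable M K \<and> (\<forall>\<omega>\<in>space M. potential t \<omega> \<le> K \<omega>)"
proof (induction t)
  case 0
  show ?case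
    by (rule exI[of _ "\<lambda>_. (norm (r1 - us))\<^sup>2 / 2"]) (simp add: potential_0)
next
  case (Suc t)
  then obtain K where K: "integrable M K" "\<And>\<omega>. \<omega> \<in> space M \<Longrightarrow> potential t \<omega> \<le> K \<omega>" by blast
  let ?t = "Suc t"
  let ?K = "\<lambda>\<omega>. 3 * K \<omega> + noise ?t \<omega> + ((\<gamma> ?t)\<^sup>2 / (q - c\<^sup>2) + (\<gamma> ?t)\<^sup>2 / 2) * (norm (dH2 ?t \<omega>))\<^sup>2
    + (\<gamma> ?t)\<^sup>2 / 2 * (norm (dG ?t \<omega>))\<^sup>2"
  have "integrable M ?K"
    using K(1) noise_expectation(1)[of ?t] square_integrable_errors[of ?t, THEN square_integrableD(2)]
    by simp
  moreover have "potential ?t \<omega> \<le> ?K \<omega>" if \<omega>: "\<omega> \<in> space M" for \<omega>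
  proof -
    have "0 \<le> (q - c\<^sup>2) / 4 * (norm (w (?t + 1) \<omega> - r ?t \<omega>))\<^sup>2" using c2_less by simp
    then show ?thesis using potential_step[OF \<omega>, of ?t] K(2)[OF \<omega>] by simp
  qed
  ultimately show ?case by blast
qed

lemma measurable_r: "t \<ge> 1 \<Longrightarrow> r t \<in> borel_measurable M"
  and measurable_wag: "t \<ge> 1 \<Longrightarrow> wag t \<in> borel_measurable M"
  and measurable_w: "t \<ge> 1 \<Longrightarrow> w (t + 1) \<in> borel_measurable M"
  using measurable_iterates measurable_past by blast+

lemma square_integrable_r:
  assumes t: "t \<ge> 1" shows "square_integrable M (\<lambda>\<omega>. r t \<omega> - us)"
proof -
  obtain K where K: "integrable M K" "\<And>\<omega>. \<omega> \<in> space M \<Longrightarrow> potential (t - 1) \<omega> \<le> K \<omega>"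
    using potential_bound by blast
  show ?thesis
  proof (rule square_integrable_bound)
    show "integrable M (\<lambda>\<omega>. 2 * K \<omega>)" using K by simp
    show "(norm (r t \<omega> - us))\<^sup>2 \<le> 2 * K \<omega>" if "\<omega> \<in> space M" for \<omega>
      using potential_ge[OF that, of "t - 1"] K(2)[OF that] t by simp
  qed (use t measurable_r in simp)
qed

text \<open>Here the displacement term kept on the left of \<open>potential_step\<close> is used,
  after discarding the nonnegative new potential.\<close>

lemma square_integrable_w_diff:
  assumes t: "t \<ge> 1" shows "square_integrable M (\<lambda>\<omega>. w (t + 1) \<omega> - r t \<omega>)"
proof -
  obtain K where K: "integrable M K" "\<And>\<omega>. \<omega> \<in> space M \<Longrightarrow> potential (t - 1) \<omega> \<le> K \<omega>"
    using potential_bound by blast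
  let ?K = "\<lambda>\<omega>. 3 * K \<omega> + noise t \<omega> + ((\<gamma> t)\<^sup>2 / (q - c\<^sup>2) + (\<gamma> t)\<^sup>2 / 2) * (norm (dH2 t \<omega>))\<^sup>2
    + (\<gamma> t)\<^sup>2 / 2 * (norm (dG t \<omega>))\<^sup>2"
  show ?thesis
  proof (rule square_integrable_bound)
    show "integrable M (\<lambda>\<omega>. 4 / (q - c\<^sup>2) * ?K \<omega>)"
      using K(1) noise_expectation(1)[OF t] square_integrable_errors[OF t, THEN square_integrableD(2)]
      by simp
    show "(norm (w (t + 1) \<omega> - r t \<omega>))\<^sup>2 \<le> 4 / (q - c\<^sup>2) * ?K \<omega>" if \<omega>: "\<omega> \<in> space M" for \<omega>
    proof -
      have "0 \<le> potential t \<omega>"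
        using potential_ge[OF \<omega>, of t] zero_le_power2[of "norm (r (t + 1) \<omega> - us)"] by linarith
      then have "(q - c\<^sup>2) / 4 * (norm (w (t + 1) \<omega> - r t \<omega>))\<^sup>2 \<le> ?K \<omega>"
        using potential_step[OF \<omega> t] K(2)[OF \<omega>] by linarith
      then have "4 / (q - c\<^sup>2) * ((q - c\<^sup>2) / 4 * (norm (w (t + 1) \<omega> - r t \<omega>))\<^sup>2) \<le> 4 / (q - c\<^sup>2) * ?K \<omega>"
        using c2_less by (intro mult_left_mono) auto
      then show ?thesis using c2_less by simp
    qed
  qed (use t measurable_r measurable_w in simp)
qed

lemma square_integrable_w:
  assumes t: "t \<ge> 1" shows "square_integrable M (\<lambda>\<omega>. w (t + 1) \<omega> - us)"
  using square_integrable_add[OF square_integrable_w_diff[OF t] square_integrable_r[OF t]] by simp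

lemma square_integrable_wag:
  assumes t: "t \<ge> 1" shows "square_integrable M (\<lambda>\<omega>. wag (t + 1) \<omega> - us)"
proof (rule square_integrable_bound)
  show "integrable M (\<lambda>\<omega>. (\<Sum>i=1..t. \<gamma> i * (norm (w (i + 1) \<omega> - us))\<^sup>2) / S t)"
    by (intro integrable_divide Bochner_Integration.integrable_sum integrable_mult_right
        square_integrableD(2)[OF square_integrable_w]) auto
  show "(norm (wag (t + 1) \<omega> - us))\<^sup>2 \<le> (\<Sum>i=1..t. \<gamma> i * (norm (w (i + 1) \<omega> - us))\<^sup>2) / S t"
    if "\<omega> \<in> space M" for \<omega>
    using wag_dist[OF that, of t] S_pos[OF t] by (simp add: pos_le_divide_eq mult.commute)
qed (use t measurable_wag[of "t + 1"] in simp)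

text \<open>Square integrability of the iterates is now available, so each product is integrable; it
  has mean zero because \<open>w (i + 1)\<close> precedes \<open>\<zeta> (2 * i)\<close> and
  \<open>r i\<close> precedes \<open>\<xi> i\<close>.\<close>

lemma mart_expectation: "integrable M (mart t)" "(\<integral>\<omega>. mart t \<omega> \<partial>M) = 0"
proof -
  have H2: "integrable M (\<lambda>\<omega>. dH2 i \<omega> \<bullet> (w (i + 1) \<omega> - us))" "(\<integral>\<omega>. dH2 i \<omega> \<bullet> (w (i + 1) \<omega> - us) \<partial>M) = 0"
    if i: "i \<ge> 1" for i
    by (rule dH2_moments(3,4)[OF i _ square_integrableD(2)[OF square_integrable_w[OF i]]],
        use measurable_iterates(4)[OF i] in simp)+
  have G: "integrable M (\<lambda>\<omega>. dG i \<omega> \<bullet> (r i \<omega> - us))" "(\<integral>\<omega>. dG i \<omega> \<bullet> (r i \<omega> - us) \<partial>M) = 0"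
    if i: "i \<ge> 1" for i
    by (rule dG_moments(3,4)[OF i _ square_integrableD(2)[OF square_integrable_r[OF i]]],
        use measurable_iterates(1)[OF i] in simp)+
  show "integrable M (mart t)"
    unfolding mart_def[abs_def] using H2(1) G(1)
    by (intro Bochner_Integration.integrable_sum integrable_mult_right Bochner_Integration.integrable_add) auto
  have "(\<integral>\<omega>. mart t \<omega> \<partial>M)
      = (\<Sum>i=1..t. \<integral>\<omega>. \<gamma> i * (dH2 i \<omega> \<bullet> (w (i + 1) \<omega> - us) + dG i \<omega> \<bullet> (r i \<omega> - us)) \<partial>M)"
    unfolding mart_def using H2(1) G(1)
    by (intro Bochner_Integration.integral_sum integrable_mult_right Bochner_Integration.integrable_add) auto
  also have "\<dots> = (\<Sum>i=1..t. \<gamma> i * ((\<integral>\<omega>. dH2 i \<omega> \<bullet> (w (i + 1) \<omega> - us) \<partial>M) + (\<integral>\<omega>. dG i \<omega> \<bullet> (r i \<omega> - us) \<partial>M)))"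
    using H2(1) G(1) by (intro sum.cong) auto
  also have "\<dots> = 0" using H2(2) G(2) by (intro sum.neutral) auto
  finally show "(\<integral>\<omega>. mart t \<omega> \<partial>M) = 0" .
qed

lemma expectation_norm_add_orthogonal:
  assumes f: "square_integrable M f" and e: "square_integrable M e"
    and orth: "integrable M (\<lambda>\<omega>. e \<omega> \<bullet> f \<omega>)" "(\<integral>\<omega>. e \<omega> \<bullet> f \<omega> \<partial>M) = 0"
  shows "(\<integral>\<omega>. (norm (f \<omega> + a *\<^sub>R e \<omega>))\<^sup>2 \<partial>M)
    = (\<integral>\<omega>. (norm (f \<omega>))\<^sup>2 \<partial>M) + a\<^sup>2 * (\<integral>\<omega>. (norm (e \<omega> :: 'a))\<^sup>2 \<partial>M)"
proof -
  have "(norm (f \<omega> + a *\<^sub>R e \<omega>))\<^sup>2 = (norm (f \<omega>))\<^sup>2 + a\<^sup>2 * (norm (e \<omega>))\<^sup>2 + 2 * a * (e \<omega> \<bullet> f \<omega>)" for \<omega>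
    unfolding power2_norm_eq_inner by (simp add: inner_add inner_commute power2_eq_square)
  then show ?thesis
    using square_integrableD(2)[OF f] square_integrableD(2)[OF e] orth by simp
qed

text \<open>Orthogonality of successive errors: every new one has zero mean against the sum
  accumulated so far, so only the diagonal terms remain.\<close>

lemma err_sum_second_moment:
  "square_integrable M (err_sum t)
    \<and> (\<integral>\<omega>. (norm (err_sum t \<omega>))\<^sup>2 \<partial>M) \<le> (\<sigma>_H\<^sup>2 + \<sigma>_G\<^sup>2) * (\<Sum>i=1..t. (\<gamma> i)\<^sup>2)"
proof (induction t)
  case 0
  then show ?case by (simp add: err_sum_def[abs_def] square_integrable_def)
next
  case (Suc t)
  let ?t = "Suc t"
  \<comment> \<open>An iteration adds two errors. \<open>dG\<close> is added first, since
    \<open>dH2\<close> is orthogonal also to what depends on the current sample of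
    \<open>\<G>\<close>.\<close>
  define A where "A \<omega> = err_sum t \<omega> + \<gamma> ?t *\<^sub>R dG ?t \<omega>" for \<omega>
  note err = square_integrable_errors[of ?t]
  have sA: "square_integrable M A"
    unfolding A_def[abs_def] using Suc err by (intro square_integrable_add square_integrable_scaleR) auto
  have eq: "err_sum ?t \<omega> = A \<omega> + \<gamma> ?t *\<^sub>R dH2 ?t \<omega>" for \<omega> by (simp add: err_sum_def A_def)
  have "err_sum t \<in> borel_measurable (past ?t (2 * ?t - 1))"
    by (rule measurable_past_mono[OF measurable_err_sum]) auto
  then have mA: "A \<in> borel_measurable (past ?t (2 * ?t - 1))"
    unfolding A_def[abs_def] using measurable_errors(1)[of ?t] by simp
  have "square_integrable M (err_sum ?t)"
    unfolding eq[abs_def] using sA err by (intro square_integrable_add square_integrable_scaleR) auto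
  moreover have "(\<integral>\<omega>. (norm (err_sum ?t \<omega>))\<^sup>2 \<partial>M)
      = (\<integral>\<omega>. (norm (A \<omega>))\<^sup>2 \<partial>M) + (\<gamma> ?t)\<^sup>2 * (\<integral>\<omega>. (norm (dH2 ?t \<omega>))\<^sup>2 \<partial>M)"
    unfolding eq using dH2_moments(3,4)[OF _ mA square_integrableD(2)[OF sA]]
    by (intro expectation_norm_add_orthogonal sA err) auto
  moreover have "(\<integral>\<omega>. (norm (A \<omega>))\<^sup>2 \<partial>M)
      = (\<integral>\<omega>. (norm (err_sum t \<omega>))\<^sup>2 \<partial>M) + (\<gamma> ?t)\<^sup>2 * (\<integral>\<omega>. (norm (dG ?t \<omega>))\<^sup>2 \<partial>M)"
    unfolding A_def using Suc dG_moments(3,4)[of ?t "err_sum t"] measurable_err_sum[of t]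
    by (intro expectation_norm_add_orthogonal err) (auto simp: square_integrable_def)
  moreover have "(\<gamma> ?t)\<^sup>2 * (\<integral>\<omega>. (norm (dH2 ?t \<omega>))\<^sup>2 \<partial>M) \<le> (\<gamma> ?t)\<^sup>2 * \<sigma>_H\<^sup>2"
    using dH2_moments(2)[of ?t "\<lambda>_. 0"] by (intro mult_left_mono) auto
  moreover have "(\<gamma> ?t)\<^sup>2 * (\<integral>\<omega>. (norm (dG ?t \<omega>))\<^sup>2 \<partial>M) \<le> (\<gamma> ?t)\<^sup>2 * \<sigma>_G\<^sup>2"
    using dG_moments(2)[of ?t "\<lambda>_. 0"] by (intro mult_left_mono) auto
  ultimately show ?case using Suc by (simp add: algebra_simps)
qed

end

section \<open>Bounds in expectation\<close>

context stochastic_amp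
begin

definition noise_bound :: "nat \<Rightarrow> real" where
  "noise_bound t = (3 * \<sigma>_H\<^sup>2 + \<sigma>_G\<^sup>2 / (2 * (1 - q))) * (\<Sum>i=1..t. (\<gamma> i)\<^sup>2)"

lemma noise_bound_mono: "i \<le> t \<Longrightarrow> noise_bound i \<le> noise_bound t"
  unfolding noise_bound_def using q_less
  by (intro mult_left_mono sum_mono2) auto

lemma noise_sum_expectation:
  "integrable M (\<lambda>\<omega>. \<Sum>i=1..t. noise i \<omega>)" "(\<integral>\<omega>. (\<Sum>i=1..t. noise i \<omega>) \<partial>M) \<le> noise_bound t"
proof -
  show "integrable M (\<lambda>\<omega>. \<Sum>i=1..t. noise i \<omega>)"
    using noise_expectation(1) by (intro Bochner_Integration.integrable_sum) auto
  have "(\<integral>\<omega>. (\<Sum>i=1..t. noise i \<omega>) \<partial>M) = (\<Sum>i=1..t. \<integral>\<omega>. noise i \<omega> \<partial>M)"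
    using noise_expectation(1) by (intro Bochner_Integration.integral_sum) auto
  also have "\<dots> \<le> (\<Sum>i=1..t. (\<gamma> i)\<^sup>2 * (3 * \<sigma>_H\<^sup>2 + \<sigma>_G\<^sup>2 / (2 * (1 - q))))"
    using noise_expectation(2) by (intro sum_mono) auto
  also have "\<dots> = noise_bound t"
    unfolding noise_bound_def sum_distrib_right[symmetric] by (rule mult.commute)
  finally show "(\<integral>\<omega>. (\<Sum>i=1..t. noise i \<omega>) \<partial>M) \<le> noise_bound t" .
qed

lemma r_dist_expectation:
  assumes t: "t \<ge> 1"
  shows "(\<integral>\<omega>. (norm (r (t + 1) \<omega> - us))\<^sup>2 \<partial>M) + (q - c\<^sup>2) * (\<integral>\<omega>. (norm (w (t + 1) \<omega> - r t \<omega>))\<^sup>2 \<partial>M)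
    \<le> (norm (r1 - us))\<^sup>2 + 2 * noise_bound t"
proof -
  have ir: "integrable M (\<lambda>\<omega>. (norm (r (t + 1) \<omega> - us))\<^sup>2)"
    using square_integrable_r[of "t + 1"] by (simp add: square_integrable_def)
  note iw = square_integrableD(2)[OF square_integrable_w_diff[OF t]]
  note i = noise_sum_expectation(1) mart_expectation(1)
  have "(\<integral>\<omega>. (norm (r (t + 1) \<omega> - us))\<^sup>2 + (q - c\<^sup>2) * (norm (w (t + 1) \<omega> - r t \<omega>))\<^sup>2 \<partial>M)
      \<le> (\<integral>\<omega>. (norm (r1 - us))\<^sup>2 + 2 * (\<Sum>i=1..t. noise i \<omega>) - 2 * mart t \<omega> \<partial>M)"
  proof (rule integral_mono)
    fix \<omega> assume \<omega>: "\<omega> \<in> space M"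
    \<comment> \<open>Only the last displacement is kept, the one that occurs in
      \<open>w_dist\<close>.\<close>
    have "(norm (w (t + 1) \<omega> - r t \<omega>))\<^sup>2 \<le> (\<Sum>i=1..t. (norm (w (i + 1) \<omega> - r i \<omega>))\<^sup>2)"
      using t by (intro member_le_sum) auto
    then have "(q - c\<^sup>2) * (norm (w (t + 1) \<omega> - r t \<omega>))\<^sup>2
        \<le> (q - c\<^sup>2) * (\<Sum>i=1..t. (norm (w (i + 1) \<omega> - r i \<omega>))\<^sup>2)"
      using c2_less by (intro mult_left_mono) auto
    then show "(norm (r (t + 1) \<omega> - us))\<^sup>2 + (q - c\<^sup>2) * (norm (w (t + 1) \<omega> - r t \<omega>))\<^sup>2
        \<le> (norm (r1 - us))\<^sup>2 + 2 * (\<Sum>i=1..t. noise i \<omega>) - 2 * mart t \<omega>"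
      using r_dist[OF \<omega>, of t] by linarith
  qed (use ir iw i in simp_all)
  also have "\<dots> = (norm (r1 - us))\<^sup>2 + 2 * (\<integral>\<omega>. (\<Sum>i=1..t. noise i \<omega>) \<partial>M) - 2 * (\<integral>\<omega>. mart t \<omega> \<partial>M)"
    using i[of t] by (simp add: prob_space del: Bochner_Integration.integral_sum)
  also have "\<dots> \<le> (norm (r1 - us))\<^sup>2 + 2 * noise_bound t"
    using noise_sum_expectation(2)[of t] mart_expectation(2)[of t] by linarith
  finally show ?thesis using ir iw by simp
qed

text \<open>The two conditions on \<open>\<theta>\<close> state that \<open>2 * \<theta>\<close>
  times the left side of \<open>r_dist_expectation\<close> dominates the corresponding terms of
  \<open>w_dist\<close>; their least common solution is the maximum in the theorem. The 12 is 6
  times the two variances of the \<open>\<H>\<close> errors.\<close>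

lemma w_dist_expectation:
  assumes i: "i \<ge> 1" and \<theta>: "1 \<le> \<theta>" "c\<^sup>2 \<le> \<theta> * (q - c\<^sup>2)"
  shows "(\<integral>\<omega>. (norm (w (i + 1) \<omega> - us))\<^sup>2 \<partial>M)
    \<le> 2 * \<theta> * ((norm (r1 - us))\<^sup>2 + 2 * noise_bound i) + 12 * (\<gamma> i)\<^sup>2 * \<sigma>_H\<^sup>2"
proof -
  let ?r = "\<lambda>\<omega>. (norm (r (i + 1) \<omega> - us))\<^sup>2" and ?w = "\<lambda>\<omega>. (norm (w (i + 1) \<omega> - r i \<omega>))\<^sup>2"
  have ir: "integrable M ?r"
    using square_integrable_r[of "i + 1"] by (simp add: square_integrable_def)
  note iw = square_integrableD(2)[OF square_integrable_w_diff[OF i]]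
  note err = square_integrable_errors[OF i, THEN square_integrableD(2)]
  have "(\<integral>\<omega>. (norm (w (i + 1) \<omega> - us))\<^sup>2 \<partial>M) \<le> (\<integral>\<omega>. 2 * ?r \<omega> + 2 * c\<^sup>2 * ?w \<omega>
      + 6 * (\<gamma> i)\<^sup>2 * ((norm (dH1 i \<omega>))\<^sup>2 + (norm (dH2 i \<omega>))\<^sup>2) \<partial>M)"
  proof (rule integral_mono)
    show "integrable M (\<lambda>\<omega>. (norm (w (i + 1) \<omega> - us))\<^sup>2)"
      by (rule square_integrableD(2)[OF square_integrable_w[OF i]])
    show "integrable M (\<lambda>\<omega>. 2 * ?r \<omega> + 2 * c\<^sup>2 * ?w \<omega>
      + 6 * (\<gamma> i)\<^sup>2 * ((norm (dH1 i \<omega>))\<^sup>2 + (norm (dH2 i \<omega>))\<^sup>2))"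
      using ir iw err by simp
  qed (rule w_dist[OF _ i])
  also have "\<dots> = 2 * integral\<^sup>L M ?r + 2 * c\<^sup>2 * integral\<^sup>L M ?w
      + 6 * (\<gamma> i)\<^sup>2 * ((\<integral>\<omega>. (norm (dH1 i \<omega>))\<^sup>2 \<partial>M) + (\<integral>\<omega>. (norm (dH2 i \<omega>))\<^sup>2 \<partial>M))"
    using ir iw err by simp
  also have "\<dots> \<le> 2 * (\<theta> * integral\<^sup>L M ?r) + 2 * (\<theta> * (q - c\<^sup>2) * integral\<^sup>L M ?w)
      + 6 * (\<gamma> i)\<^sup>2 * (\<sigma>_H\<^sup>2 + \<sigma>_H\<^sup>2)"
  proof -
    have "1 * integral\<^sup>L M ?r \<le> \<theta> * integral\<^sup>L M ?r" "c\<^sup>2 * integral\<^sup>L M ?w \<le> \<theta> * (q - c\<^sup>2) * integral\<^sup>L M ?w"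
      by (rule mult_right_mono[OF \<theta>(1)] mult_right_mono[OF \<theta>(2)]; simp)+
    moreover have "6 * (\<gamma> i)\<^sup>2 * ((\<integral>\<omega>. (norm (dH1 i \<omega>))\<^sup>2 \<partial>M) + (\<integral>\<omega>. (norm (dH2 i \<omega>))\<^sup>2 \<partial>M))
        \<le> 6 * (\<gamma> i)\<^sup>2 * (\<sigma>_H\<^sup>2 + \<sigma>_H\<^sup>2)"
      using dH1_moments(2)[OF i] dH2_moments(2)[OF i, of "\<lambda>_. 0"] by (intro mult_left_mono) auto
    ultimately show ?thesis by linarith
  qed
  also have "\<dots> = 2 * \<theta> * (integral\<^sup>L M ?r + (q - c\<^sup>2) * integral\<^sup>L M ?w) + 12 * (\<gamma> i)\<^sup>2 * \<sigma>_H\<^sup>2"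
    by (simp add: algebra_simps)
  also have "\<dots> \<le> 2 * \<theta> * ((norm (r1 - us))\<^sup>2 + 2 * noise_bound i) + 12 * (\<gamma> i)\<^sup>2 * \<sigma>_H\<^sup>2"
    using \<theta> by (intro add_right_mono mult_left_mono r_dist_expectation i) auto
  finally show ?thesis .
qed

text \<open>Averaging with weights \<open>\<gamma> i\<close> leaves the main term unchanged, once
  \<open>noise_bound i\<close> is enlarged to \<open>noise_bound t\<close>, and turns the squares of
  \<open>w_dist_expectation\<close> into cubes.\<close>

lemma wag_dist_expectation:
  assumes t: "t \<ge> 1" and \<theta>: "1 \<le> \<theta>" "c\<^sup>2 \<le> \<theta> * (q - c\<^sup>2)"
  shows "(\<integral>\<omega>. (norm (wag (t + 1) \<omega> - us))\<^sup>2 \<partial>M)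
    \<le> 2 * \<theta> * ((norm (r1 - us))\<^sup>2 + 2 * noise_bound t) + 12 * \<sigma>_H\<^sup>2 * (\<Sum>i=1..t. (\<gamma> i) ^ 3) / S t"
proof -
  let ?K = "2 * \<theta> * ((norm (r1 - us))\<^sup>2 + 2 * noise_bound t)"
  have iw: "integrable M (\<lambda>\<omega>. \<gamma> i * (norm (w (i + 1) \<omega> - us))\<^sup>2)" if "i \<in> {1..t}" for i
    using square_integrableD(2)[OF square_integrable_w[of i]] that by simp
  note iwag = square_integrableD(2)[OF square_integrable_wag[OF t]]
  have "S t * (\<integral>\<omega>. (norm (wag (t + 1) \<omega> - us))\<^sup>2 \<partial>M) = (\<integral>\<omega>. S t * (norm (wag (t + 1) \<omega> - us))\<^sup>2 \<partial>M)"
    by simp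
  also have "\<dots> \<le> (\<integral>\<omega>. (\<Sum>i=1..t. \<gamma> i * (norm (w (i + 1) \<omega> - us))\<^sup>2) \<partial>M)"
  proof (rule integral_mono)
    show "integrable M (\<lambda>\<omega>. S t * (norm (wag (t + 1) \<omega> - us))\<^sup>2)"
      by (rule integrable_mult_right) (rule iwag)
    show "integrable M (\<lambda>\<omega>. \<Sum>i=1..t. \<gamma> i * (norm (w (i + 1) \<omega> - us))\<^sup>2)"
      by (rule Bochner_Integration.integrable_sum) (rule iw)
  qed (rule wag_dist)
  also have "\<dots> = (\<Sum>i=1..t. \<integral>\<omega>. \<gamma> i * (norm (w (i + 1) \<omega> - us))\<^sup>2 \<partial>M)"
    by (rule Bochner_Integration.integral_sum) (rule iw)
  also have "\<dots> \<le> (\<Sum>i=1..t. \<gamma> i * ?K + 12 * \<sigma>_H\<^sup>2 * (\<gamma> i) ^ 3)"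
  proof (rule sum_mono)
    fix i assume i: "i \<in> {1..t}"
    then have i1: "i \<ge> 1" by simp
    have "2 * \<theta> * ((norm (r1 - us))\<^sup>2 + 2 * noise_bound i) \<le> ?K"
      using i \<theta> noise_bound_mono[of i t] by (intro mult_left_mono) auto
    then have "(\<integral>\<omega>. (norm (w (i + 1) \<omega> - us))\<^sup>2 \<partial>M) \<le> ?K + 12 * (\<gamma> i)\<^sup>2 * \<sigma>_H\<^sup>2"
      by (rule order_trans[OF w_dist_expectation[OF i1 \<theta>] add_right_mono])
    then have "\<gamma> i * (\<integral>\<omega>. (norm (w (i + 1) \<omega> - us))\<^sup>2 \<partial>M) \<le> \<gamma> i * (?K + 12 * (\<gamma> i)\<^sup>2 * \<sigma>_H\<^sup>2)"
      using \<gamma>_pos[of i] i by (intro mult_left_mono) auto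
    also have "\<dots> = \<gamma> i * ?K + 12 * \<sigma>_H\<^sup>2 * (\<gamma> i) ^ 3"
      by (simp only: distrib_left power2_eq_square power3_eq_cube) (simp add: mult_ac)
    finally show "(\<integral>\<omega>. \<gamma> i * (norm (w (i + 1) \<omega> - us))\<^sup>2 \<partial>M) \<le> \<gamma> i * ?K + 12 * \<sigma>_H\<^sup>2 * (\<gamma> i) ^ 3"
      by simp
  qed
  also have "\<dots> = S t * ?K + 12 * \<sigma>_H\<^sup>2 * (\<Sum>i=1..t. (\<gamma> i) ^ 3)"
    by (simp only: sum.distrib sum_distrib_left sum_distrib_right)
  finally show ?thesis using S_pos[OF t] by (simp add: field_simps)
qed

text \<open>The constant \<open>C2\<close> is the sum of two bounds: \<open>noise_bound t\<close>
  contributes 3 of the 4 copies of \<open>\<sigma>_H\<^sup>2\<close> and the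
  \<open>q\<close>-dependent part of \<open>\<sigma>_G\<^sup>2\<close>; the second moment of
  \<open>err_sum\<close> contributes the rest. The 18 is 3/2 from the residual times the 12 of
  \<open>wag_dist_expectation\<close>.\<close>

lemma perturbation_exists:
  assumes t: "t \<ge> 1" and \<theta>: "1 \<le> \<theta>" "c\<^sup>2 \<le> \<theta> * (q - c\<^sup>2)"
    and D: "D = norm (r1 - us)"
    and C2: "C2 = (4 * \<sigma>_H\<^sup>2 + (1 + 1 / (2 * (1 - q))) * \<sigma>_G\<^sup>2) * (\<Sum>i=1..t. (\<gamma> i)\<^sup>2)"
  obtains v :: "'w \<Rightarrow> 'a" and \<epsilon> :: "'w \<Rightarrow> real"
  where "v \<in> borel_measurable M" "\<epsilon> \<in> borel_measurable M"
    and "\<And>\<omega>. \<omega> \<in> space M \<Longrightarrow> 0 \<le> \<epsilon> \<omega>"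
    and "\<And>\<omega>. \<omega> \<in> space M \<Longrightarrow> perturbed_gap Z G H J (wag (t + 1) \<omega>) (v \<omega>) \<le> ereal (\<epsilon> \<omega>)"
    and "integrable M (\<lambda>\<omega>. norm (v \<omega>))"
    and "(\<integral>\<omega>. norm (v \<omega>) \<partial>M) \<le> 1 / S t * (2 * D + 2 * sqrt (D\<^sup>2 + C2))"
    and "integrable M \<epsilon>"
    and "(\<integral>\<omega>. \<epsilon> \<omega> \<partial>M) \<le> 1 / S t * ((3 + 6 * \<theta>) * D\<^sup>2 + (1 + 6 * \<theta>) * C2)
      + 18 * \<sigma>_H\<^sup>2 / (S t)\<^sup>2 * (\<Sum>i=1..t. (\<gamma> i) ^ 3)"
proof -
  define \<Sigma> where "\<Sigma> = (\<Sum>i=1..t. (\<gamma> i)\<^sup>2)"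
  have \<Sigma>: "0 \<le> \<Sigma>" unfolding \<Sigma>_def by (intro sum_nonneg) auto
  define E where "E = (\<sigma>_G\<^sup>2 / (2 * (1 - q))) * \<Sigma>"
  have N: "noise_bound t = 3 * (\<sigma>_H\<^sup>2 * \<Sigma>) + E"
    unfolding noise_bound_def E_def \<Sigma>_def by (simp only: distrib_right mult.assoc)
  have C2': "C2 = 4 * (\<sigma>_H\<^sup>2 * \<Sigma>) + \<sigma>_G\<^sup>2 * \<Sigma> + E"
    unfolding C2 E_def \<Sigma>_def[symmetric] by (simp add: distrib_right)
  have nn: "0 \<le> \<sigma>_H\<^sup>2 * \<Sigma>" "0 \<le> \<sigma>_G\<^sup>2 * \<Sigma>" using \<Sigma> by simp_all
  define v where "v \<omega> = (1 / S t) *\<^sub>R (r1 - r (t + 1) \<omega> - err_sum t \<omega>)" for \<omega>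
  define \<epsilon> where "\<epsilon> \<omega> = ((norm (r1 - us))\<^sup>2 + 3 / 2 * (norm (wag (t + 1) \<omega> - us))\<^sup>2
    + (\<Sum>i=1..t. noise i \<omega>) - mart t \<omega> + (norm (err_sum t \<omega>))\<^sup>2 / 2) / S t" for \<omega>
  have sr: "square_integrable M (\<lambda>\<omega>. r (t + 1) \<omega> - us)" using square_integrable_r[of "t + 1"] by simp
  have sA: "square_integrable M (err_sum t)"
    and A2: "(\<integral>\<omega>. (norm (err_sum t \<omega>))\<^sup>2 \<partial>M) \<le> (\<sigma>_H\<^sup>2 + \<sigma>_G\<^sup>2) * \<Sigma>"
    using err_sum_second_moment[of t] by (auto simp: \<Sigma>_def)
  note int = square_integrableD(2)[OF sr] square_integrableD(2)[OF sA]
    square_integrableD(2)[OF square_integrable_wag[OF t]] noise_sum_expectation(1)[of t]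
    mart_expectation(1)[of t]
  have r2: "(\<integral>\<omega>. (norm (r (t + 1) \<omega> - us))\<^sup>2 \<partial>M) \<le> D\<^sup>2 + 2 * noise_bound t"
  proof -
    have "0 \<le> (q - c\<^sup>2) * (\<integral>\<omega>. (norm (w (t + 1) \<omega> - r t \<omega>))\<^sup>2 \<partial>M)"
      using c2_less by (intro mult_nonneg_nonneg integral_nonneg_AE) auto
    then show ?thesis using r_dist_expectation[OF t] by (simp add: D)
  qed
  have vm: "v \<in> borel_measurable M"
    unfolding v_def[abs_def] using square_integrableD(1)[OF sA] measurable_r[of "t + 1"] by simp
  have \<epsilon>_int: "integrable M \<epsilon>"
    unfolding \<epsilon>_def[abs_def] using int by (simp del: Bochner_Integration.integrable_sum)
  \<comment> \<open>The two random parts of \<open>v\<close> are bundled before the expectation is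
    compared with the root of the second moment, which gives a single square root in the
    bound.\<close>
  define f where "f \<omega> = norm (r (t + 1) \<omega> - us) + norm (err_sum t \<omega>)" for \<omega>
  have f2: "(f \<omega>)\<^sup>2 \<le> 2 * ((norm (r (t + 1) \<omega> - us))\<^sup>2 + (norm (err_sum t \<omega>))\<^sup>2)" for \<omega>
    unfolding f_def using norm_add_squared_le[of "norm (r (t + 1) \<omega> - us)" "norm (err_sum t \<omega>)"] by simp
  have fm: "f \<in> borel_measurable M"
    unfolding f_def[abs_def] using square_integrableD(1)[OF sA] square_integrableD(1)[OF sr] by simp
  have f2_int: "integrable M (\<lambda>\<omega>. (f \<omega>)\<^sup>2)"
    using square_integrable_bound[OF fm, of "\<lambda>\<omega>. 2 * ((norm (r (t + 1) \<omega> - us))\<^sup>2 + (norm (err_sum t \<omega>))\<^sup>2)"]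
      f2 int(1,2) by (simp add: square_integrable_def)
  have "(\<integral>\<omega>. (f \<omega>)\<^sup>2 \<partial>M)
      \<le> (\<integral>\<omega>. 2 * ((norm (r (t + 1) \<omega> - us))\<^sup>2 + (norm (err_sum t \<omega>))\<^sup>2) \<partial>M)"
    using f2_int int(1,2) f2 by (intro integral_mono) auto
  also have "\<dots> = 2 * ((\<integral>\<omega>. (norm (r (t + 1) \<omega> - us))\<^sup>2 \<partial>M) + (\<integral>\<omega>. (norm (err_sum t \<omega>))\<^sup>2 \<partial>M))"
    using int(1,2) by simp
  also have "\<dots> \<le> 2 * (D\<^sup>2 + 2 * noise_bound t + (\<sigma>_H\<^sup>2 + \<sigma>_G\<^sup>2) * \<Sigma>)" using r2 A2 by simp
  also have "\<dots> \<le> 4 * (D\<^sup>2 + C2)"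
    using nn zero_le_power2[of D] unfolding N C2' distrib_right distrib_left by linarith
  finally have "expectation f \<le> sqrt (4 * (D\<^sup>2 + C2))"
    using expectation_le_sqrt(2)[OF fm f2_int] by (blast intro: order_trans real_sqrt_le_mono)
  then have Ef: "expectation f \<le> 2 * sqrt (D\<^sup>2 + C2)" by (simp only: real_sqrt_mult) simp
  have fi: "integrable M f" by (rule expectation_le_sqrt(1)[OF fm f2_int])
  have v_le: "norm (v \<omega>) \<le> 1 / S t * (D + f \<omega>)" for \<omega>
  proof -
    have "r1 - r (t + 1) \<omega> - err_sum t \<omega> = (r1 - us) - (r (t + 1) \<omega> - us) - err_sum t \<omega>" by simp
    then have "norm (r1 - r (t + 1) \<omega> - err_sum t \<omega>) \<le> D + f \<omega>"
      unfolding D f_def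
      using norm_triangle_ineq4[of "(r1 - us) - (r (t + 1) \<omega> - us)" "err_sum t \<omega>"]
        norm_triangle_ineq4[of "r1 - us" "r (t + 1) \<omega> - us"] by simp
    then show ?thesis using S_pos[OF t] by (simp add: v_def divide_right_mono)
  qed
  have v_int: "integrable M (\<lambda>\<omega>. norm (v \<omega>))"
  proof (rule Bochner_Integration.integrable_bound)
    show "integrable M (\<lambda>\<omega>. 1 / S t * (D + f \<omega>))" using fi by simp
    show "AE \<omega> in M. norm (norm (v \<omega>)) \<le> norm (1 / S t * (D + f \<omega>))"
      unfolding real_norm_def abs_norm_cancel by (rule AE_I2) (rule order_trans[OF v_le abs_ge_self])
  qed (use vm in simp)
  have "(\<integral>\<omega>. norm (v \<omega>) \<partial>M) \<le> (\<integral>\<omega>. 1 / S t * (D + f \<omega>) \<partial>M)"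
    using v_int fi v_le by (intro integral_mono) auto
  also have "\<dots> = 1 / S t * (D + expectation f)" using fi by (simp add: prob_space)
  also have "\<dots> \<le> 1 / S t * (2 * D + 2 * sqrt (D\<^sup>2 + C2))"
  proof (rule mult_left_mono)
    have "0 \<le> D" by (simp add: D)
    then show "D + expectation f \<le> 2 * D + 2 * sqrt (D\<^sup>2 + C2)" using Ef by linarith
  qed (use S_pos[OF t] in simp)
  finally have Ev: "(\<integral>\<omega>. norm (v \<omega>) \<partial>M) \<le> 1 / S t * (2 * D + 2 * sqrt (D\<^sup>2 + C2))" .
  let ?T = "\<Sum>i=1..t. (\<gamma> i) ^ 3"
  have "(\<integral>\<omega>. \<epsilon> \<omega> \<partial>M) = (D\<^sup>2 + 3 / 2 * (\<integral>\<omega>. (norm (wag (t + 1) \<omega> - us))\<^sup>2 \<partial>M)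
      + (\<integral>\<omega>. (\<Sum>i=1..t. noise i \<omega>) \<partial>M) - (\<integral>\<omega>. mart t \<omega> \<partial>M) + (\<integral>\<omega>. (norm (err_sum t \<omega>))\<^sup>2 \<partial>M) / 2) / S t"
    unfolding \<epsilon>_def D using int by (simp add: prob_space del: Bochner_Integration.integral_sum)
  also have "\<dots> \<le> ((3 + 6 * \<theta>) * D\<^sup>2 + (1 + 6 * \<theta>) * C2 + 18 * \<sigma>_H\<^sup>2 * ?T / S t) / S t"
  proof (rule divide_right_mono)
    have a: "3 / 2 * (\<integral>\<omega>. (norm (wag (t + 1) \<omega> - us))\<^sup>2 \<partial>M)
        \<le> 3 * (\<theta> * D\<^sup>2) + 6 * (\<theta> * noise_bound t) + 18 * \<sigma>_H\<^sup>2 * ?T / S t"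
    proof -
      have eq: "3 / 2 * (2 * \<theta> * (d + 2 * n) + 12 * s * x / y) = 3 * (\<theta> * d) + 6 * (\<theta> * n) + 18 * s * x / y"
        for d n s x y :: real by (simp add: algebra_simps)
      have "3 / 2 * (\<integral>\<omega>. (norm (wag (t + 1) \<omega> - us))\<^sup>2 \<partial>M)
          \<le> 3 / 2 * (2 * \<theta> * (D\<^sup>2 + 2 * noise_bound t) + 12 * \<sigma>_H\<^sup>2 * ?T / S t)"
        using wag_dist_expectation[OF t \<theta>] unfolding D[symmetric] by (rule mult_left_mono) simp
      then show ?thesis unfolding eq .
    qed
    have b: "\<theta> * noise_bound t \<le> \<theta> * C2"
    proof (rule mult_left_mono)
      show "noise_bound t \<le> C2" using nn unfolding N C2' by linarith
    qed (use \<theta> in simp)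
    have d: "noise_bound t + (\<sigma>_H\<^sup>2 + \<sigma>_G\<^sup>2) * \<Sigma> / 2 \<le> C2"
      using nn unfolding N C2' distrib_right add_divide_distrib by linarith
    have e: "0 \<le> \<theta> * D\<^sup>2" "0 \<le> D\<^sup>2" using \<theta> by auto
    have g: "(3 + 6 * \<theta>) * D\<^sup>2 + (1 + 6 * \<theta>) * C2 = 3 * D\<^sup>2 + 6 * (\<theta> * D\<^sup>2) + C2 + 6 * (\<theta> * C2)"
      by (simp add: algebra_simps)
    show "D\<^sup>2 + 3 / 2 * (\<integral>\<omega>. (norm (wag (t + 1) \<omega> - us))\<^sup>2 \<partial>M)
      + (\<integral>\<omega>. (\<Sum>i=1..t. noise i \<omega>) \<partial>M) - (\<integral>\<omega>. mart t \<omega> \<partial>M) + (\<integral>\<omega>. (norm (err_sum t \<omega>))\<^sup>2 \<partial>M) / 2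
      \<le> (3 + 6 * \<theta>) * D\<^sup>2 + (1 + 6 * \<theta>) * C2 + 18 * \<sigma>_H\<^sup>2 * ?T / S t"
      unfolding g using a b d e A2 noise_sum_expectation(2)[of t] mart_expectation(2)[of t] by linarith
  qed (rule S_nonneg)
  also have "\<dots> = 1 / S t * ((3 + 6 * \<theta>) * D\<^sup>2 + (1 + 6 * \<theta>) * C2) + 18 * \<sigma>_H\<^sup>2 / (S t)\<^sup>2 * ?T"
    by (simp add: add_divide_distrib power2_eq_square)
  finally have E\<epsilon>: "(\<integral>\<omega>. \<epsilon> \<omega> \<partial>M) \<le> 1 / S t * ((3 + 6 * \<theta>) * D\<^sup>2 + (1 + 6 * \<theta>) * C2)
    + 18 * \<sigma>_H\<^sup>2 / (S t)\<^sup>2 * ?T" .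
  show thesis
    by (rule that[OF vm borel_measurable_integrable[OF \<epsilon>_int] _ _ v_int Ev \<epsilon>_int E\<epsilon>])
      (use residual_nonneg[OF _ t] perturbed_gap_le[OF _ t] in \<open>auto simp: \<epsilon>_def v_def\<close>)
qed

end

text \<open>The ratio in \<open>weights\<close> is constant, hence equal to its value
  \<open>1 / \<gamma> 1\<close> at 1. The recursion then yields
  \<open>\<Gamma> t = \<gamma> 1 / S t\<close> with \<open>S t\<close> the partial sum of
  \<open>\<gamma>\<close>, and the claim follows by eliminating \<open>\<Gamma> t\<close>.\<close>

lemma weights_eq_partial_sums:
  fixes \<alpha> \<gamma> \<Gamma> :: "nat \<Rightarrow> real"
  assumes \<gamma>: "\<And>t. t \<ge> 1 \<Longrightarrow> 0 < \<gamma> t" and \<alpha>: "\<alpha> 1 = 1" "\<And>t. t > 1 \<Longrightarrow> 0 \<le> \<alpha> t \<and> \<alpha> t < 1"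
    and \<Gamma>: "\<Gamma> 1 = 1" "\<And>t. t > 1 \<Longrightarrow> \<Gamma> t = (1 - \<alpha> t) * \<Gamma> (t - 1)"
    and weights: "\<And>t. t \<ge> 1 \<Longrightarrow> \<alpha> t / (\<Gamma> t * \<gamma> t) = \<alpha> (t + 1) / (\<Gamma> (t + 1) * \<gamma> (t + 1))"
    and t: "t \<ge> 1"
  shows "\<alpha> t * (\<Sum>i=1..t. \<gamma> i) = \<gamma> t"
proof -
  \<comment> \<open>Positivity belongs to the invariant because it allows clearing the denominators
    in \<open>weights\<close> and the final cancellation.\<close>
  have "0 < \<Gamma> t \<and> \<alpha> t * \<gamma> 1 = \<Gamma> t * \<gamma> t \<and> \<Gamma> t * (\<Sum>i=1..t. \<gamma> i) = \<gamma> 1"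
    using t
  proof (induction t rule: dec_induct)
    case base then show ?case using \<alpha> \<Gamma> by simp
  next
    case (step n)
    have pos: "0 < \<Gamma> n" "0 < \<gamma> n" "0 < \<gamma> (Suc n)" "0 < \<gamma> 1" using step \<gamma> by auto
    have rec: "\<Gamma> (Suc n) = (1 - \<alpha> (Suc n)) * \<Gamma> n" using \<Gamma>(2)[of "Suc n"] step by simp
    have pos': "0 < \<Gamma> (Suc n)" using rec \<alpha>(2)[of "Suc n"] pos step by simp
    have "\<alpha> n / (\<Gamma> n * \<gamma> n) = 1 / \<gamma> 1" using step pos by (simp add: field_simps)
    then have w: "\<alpha> (Suc n) * \<gamma> 1 = \<Gamma> (Suc n) * \<gamma> (Suc n)"
      using weights[of n] step pos pos' by (simp add: field_simps)
    have "\<Gamma> (Suc n) * (\<Sum>i=1..Suc n. \<gamma> i)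
        = (1 - \<alpha> (Suc n)) * (\<Gamma> n * (\<Sum>i=1..n. \<gamma> i)) + \<Gamma> (Suc n) * \<gamma> (Suc n)"
      by (simp add: rec algebra_simps)
    also have "\<dots> = (1 - \<alpha> (Suc n)) * \<gamma> 1 + \<alpha> (Suc n) * \<gamma> 1"
      using step by (simp only: w)
    finally show ?case using pos' w by (simp add: algebra_simps)
  qed
  then have "\<Gamma> t * (\<alpha> t * (\<Sum>i=1..t. \<gamma> i)) = \<Gamma> t * \<gamma> t" and "0 < \<Gamma> t"
    by (metis mult.left_commute)+
  then show ?thesis by simp
qed

theorem theorem3p3:
  fixes Z :: "'a::euclidean_space set"
    and G J :: "'a \<Rightarrow> real" and gradG H J' :: "'a \<Rightarrow> 'a"
    and L_G L_H :: real
    and V :: "'a \<Rightarrow> 'a \<Rightarrow> real"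
    and M :: "'w measure" and X :: "'x measure" and Y :: "'y measure"
    and \<xi> :: "nat \<Rightarrow> 'w \<Rightarrow> 'x" and \<zeta> :: "nat \<Rightarrow> 'w \<Rightarrow> 'y"
    and \<G> :: "'a \<Rightarrow> 'x \<Rightarrow> 'a" and \<H> :: "'a \<Rightarrow> 'y \<Rightarrow> 'a"
    and \<sigma>_G \<sigma>_H :: real
    and \<alpha> \<gamma> \<Gamma> :: "nat \<Rightarrow> real"
    and r1 us :: 'a
    and r w wmd wag :: "nat \<Rightarrow> 'w \<Rightarrow> 'a"
    and c q D \<theta> :: real and C :: "nat \<Rightarrow> real"
  assumes Z: "Z \<noteq> {}" "closed Z" "convex Z"
    and G_C1: "C1_gradient_on Z G gradG"
    and G_bounds: "\<forall>w\<in>Z. \<forall>v\<in>Z. 0 \<le> G w - G v - gradG v \<bullet> (w - v) \<and>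
                     G w - G v - gradG v \<bullet> (w - v) \<le> L_G / 2 * (norm (w - v))\<^sup>2"
    and H_monotone: "\<forall>w\<in>Z. \<forall>v\<in>Z. (H w - H v) \<bullet> (w - v) \<ge> 0"
    and H_Lipschitz: "\<forall>w\<in>Z. \<forall>v\<in>Z. norm (H w - H v) \<le> L_H * norm (w - v)"
    and J_convex: "convex_on Z J"
    and J_subgradient: "\<forall>u\<in>Z. is_subgradient_on Z J u (J' u)"
    and V: "\<forall>r\<in>Z. \<forall>z\<in>Z. V r z = (norm (z - r))\<^sup>2 / 2"
    and prox: "prox_well_defined Z V J"
    and us: "strong_solution Z (\<lambda>u. gradG u + H u + J' u) us"
    and prob: "prob_space M"
    and indep: "jointly_indep M X \<xi> Y \<zeta>"
    and oracle_G: "unbiased_oracle M X \<xi> Z \<G> gradG"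
    and oracle_H: "unbiased_oracle M Y \<zeta> Z \<H> H"
    and A1: "bounded_variance M \<xi> Z \<G> gradG \<sigma>_G"
            "bounded_variance M \<zeta> Z \<H> H \<sigma>_H"
    and r1: "r1 \<in> Z"
    and AMP: "\<forall>\<omega>\<in>space M. amp_run Z V J \<alpha> \<gamma> r1
                (\<lambda>t x. \<G> x (\<xi> t \<omega>)) (\<lambda>i x. \<H> x (\<zeta> i \<omega>))
                (\<lambda>t. r t \<omega>) (\<lambda>t. w t \<omega>) (\<lambda>t. wmd t \<omega>) (\<lambda>t. wag t \<omega>)"
    and \<gamma>_pos: "\<forall>t\<ge>1. \<gamma> t > 0"
    and \<alpha>: "\<alpha> 1 = 1" "\<forall>t>1. 0 \<le> \<alpha> t \<and> \<alpha> t < 1"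
    and \<Gamma>: "\<Gamma> 1 = 1" "\<forall>t>1. \<Gamma> t = (1 - \<alpha> t) * \<Gamma> (t - 1)"
    and c: "0 < c" "c < 1" and q: "0 < q" "q < 1"
    and step: "\<forall>t\<ge>1. L_G * \<alpha> t * \<gamma> t + 3 * L_H\<^sup>2 * (\<gamma> t)\<^sup>2 \<le> c\<^sup>2" "c\<^sup>2 < q"
    and weights: "\<forall>t\<ge>1. \<alpha> t / (\<Gamma> t * \<gamma> t) = \<alpha> (t + 1) / (\<Gamma> (t + 1) * \<gamma> (t + 1))"
    and D: "D = norm (r1 - us)"
    and \<theta>: "\<theta> = max 1 (c\<^sup>2 / (q - c\<^sup>2))"
    and C: "\<forall>t\<ge>1. C t = sqrt ((4 * \<sigma>_H\<^sup>2 + (1 + 1 / (2 * (1 - q))) * \<sigma>_G\<^sup>2) * (\<Sum>i=1..t. (\<gamma> i)\<^sup>2))"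
  shows "\<forall>t\<ge>1. \<exists>(v :: 'w \<Rightarrow> 'a) (\<epsilon> :: 'w \<Rightarrow> real).
           v \<in> borel_measurable M \<and> \<epsilon> \<in> borel_measurable M \<and>
           (\<forall>\<omega>\<in>space M. 0 \<le> \<epsilon> \<omega> \<and>
              perturbed_gap Z G H J (wag (t + 1) \<omega>) (v \<omega>) \<le> ereal (\<epsilon> \<omega>)) \<and>
           integrable M (\<lambda>\<omega>. norm (v \<omega>)) \<and>
           (\<integral>\<omega>. norm (v \<omega>) \<partial>M) \<le> \<alpha> t / \<gamma> t * (2 * D + 2 * sqrt (D\<^sup>2 + (C t)\<^sup>2)) \<and>
           integrable M \<epsilon> \<and>
           (\<integral>\<omega>. \<epsilon> \<omega> \<partial>M) \<le>
             \<alpha> t / \<gamma> t * ((3 + 6 * \<theta>) * D\<^sup>2 + (1 + 6 * \<theta>) * (C t)\<^sup>2)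
             + 18 * (\<alpha> t)\<^sup>2 * \<sigma>_H\<^sup>2 / (\<gamma> t)\<^sup>2 * (\<Sum>i=1..t. (\<gamma> i) ^ 3)"
proof -
  let ?S = "\<lambda>t. \<Sum>i=1..t. \<gamma> i"
  have \<alpha>S: "\<alpha> t * ?S t = \<gamma> t" if "t \<ge> 1" for t
    by (rule weights_eq_partial_sums[where \<Gamma> = \<Gamma>]) (use \<gamma>_pos \<alpha> \<Gamma> weights that in auto)
  have us_Z: "us \<in> Z" using us by (simp add: strong_solution_def)
  \<comment> \<open>The gap evaluates \<open>H\<close> at its second argument, so the
    \<open>H us\<close> part of the strong solution inequality appears in it literally; the gradient
    and subgradient inequalities at \<open>us\<close> supply the parts for \<open>G\<close> and
    \<open>J\<close>.\<close>
  have gap: "0 \<le> gap_Q G H J u us" if u: "u \<in> Z" for u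
  proof -
    have "(gradG us + H us + J' us) \<bullet> (us - u) \<le> 0" using us u by (simp add: strong_solution_def)
    moreover have "0 \<le> G u - G us - gradG us \<bullet> (u - us)" using G_bounds us_Z u by blast
    moreover have "J us + J' us \<bullet> (u - us) \<le> J u"
      using J_subgradient us_Z u by (simp add: is_subgradient_on_def)
    ultimately show ?thesis by (simp add: gap_Q_def inner_add inner_diff algebra_simps)
  qed
  have \<theta>1: "1 \<le> \<theta>" by (simp add: \<theta>)
  have "c\<^sup>2 / (q - c\<^sup>2) \<le> \<theta>" by (simp add: \<theta>)
  then have \<theta>2: "c\<^sup>2 \<le> \<theta> * (q - c\<^sup>2)" using step(2) by (simp add: pos_divide_le_eq)
  interpret stochastic_amp Z G J gradG H L_G L_H V \<alpha> \<gamma> c q us M X Y \<xi> \<zeta> \<G> \<H> \<sigma>_G \<sigma>_H r1 r w wmd wag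
  proof (intro stochastic_amp.intro amp_problem.intro oracle_samples.intro
      oracle_samples_axioms.intro stochastic_amp_axioms.intro)
    show "\<And>w v. w \<in> Z \<Longrightarrow> v \<in> Z \<Longrightarrow> G v + gradG v \<bullet> (w - v) \<le> G w"
      using G_bounds by (smt (verit, best))
    show "\<And>w v. w \<in> Z \<Longrightarrow> v \<in> Z \<Longrightarrow> G w \<le> G v + gradG v \<bullet> (w - v) + L_G / 2 * (norm (w - v))\<^sup>2"
      using G_bounds by (smt (verit, best))
    show "continuous_on Z gradG" using G_C1 by (simp add: C1_gradient_on_def)
  qed (use assms \<alpha>S us_Z gap in auto)
  show ?thesis
  proof (intro allI impI)
    fix t :: nat assume t: "t \<ge> 1"
    \<comment> \<open>Translates the bounds in terms of \<open>S t\<close> into the stated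
      form.\<close>
    have ratio: "\<alpha> t / \<gamma> t = 1 / ?S t"
      using \<alpha>S[OF t] \<gamma>_pos[OF t] S_pos[OF t] by (subst frac_eq_eq) auto
    have ratio2: "18 * (\<alpha> t)\<^sup>2 * \<sigma>_H\<^sup>2 / (\<gamma> t)\<^sup>2 = 18 * \<sigma>_H\<^sup>2 / (?S t)\<^sup>2"
    proof -
      have "18 * (\<alpha> t)\<^sup>2 * \<sigma>_H\<^sup>2 / (\<gamma> t)\<^sup>2 = 18 * \<sigma>_H\<^sup>2 * (\<alpha> t / \<gamma> t)\<^sup>2" by (simp add: power_divide)
      then show ?thesis unfolding ratio by (simp add: power_divide)
    qed
    have "0 \<le> (4 * \<sigma>_H\<^sup>2 + (1 + 1 / (2 * (1 - q))) * \<sigma>_G\<^sup>2) * (\<Sum>i=1..t. (\<gamma> i)\<^sup>2)"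
      using q by (intro mult_nonneg_nonneg add_nonneg_nonneg sum_nonneg) auto
    then have Ct: "(C t)\<^sup>2 = (4 * \<sigma>_H\<^sup>2 + (1 + 1 / (2 * (1 - q))) * \<sigma>_G\<^sup>2) * (\<Sum>i=1..t. (\<gamma> i)\<^sup>2)"
      using C t by simp
    show "\<exists>v \<epsilon>. v \<in> borel_measurable M \<and> \<epsilon> \<in> borel_measurable M \<and>
           (\<forall>\<omega>\<in>space M. 0 \<le> \<epsilon> \<omega> \<and>
              perturbed_gap Z G H J (wag (t + 1) \<omega>) (v \<omega>) \<le> ereal (\<epsilon> \<omega>)) \<and>
           integrable M (\<lambda>\<omega>. norm (v \<omega>)) \<and>
           (\<integral>\<omega>. norm (v \<omega>) \<partial>M) \<le> \<alpha> t / \<gamma> t * (2 * D + 2 * sqrt (D\<^sup>2 + (C t)\<^sup>2)) \<and>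
           integrable M \<epsilon> \<and>
           (\<integral>\<omega>. \<epsilon> \<omega> \<partial>M) \<le>
             \<alpha> t / \<gamma> t * ((3 + 6 * \<theta>) * D\<^sup>2 + (1 + 6 * \<theta>) * (C t)\<^sup>2)
             + 18 * (\<alpha> t)\<^sup>2 * \<sigma>_H\<^sup>2 / (\<gamma> t)\<^sup>2 * (\<Sum>i=1..t. (\<gamma> i) ^ 3)"
      unfolding ratio ratio2
      by (rule perturbation_exists[OF t \<theta>1 \<theta>2 D Ct]) blast
  qed
qed

end
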